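(* Let $\mathcal H$ be a complex Hilbert space and let $T\in\mathcal L(\mathcal H)$ be a contraction ($\|T\|\le 1$), with defect spaces $\mathcal D_T$, $\mathcal D_{T^*}$ and characteristic function $\Theta_T(z):\mathcal D_T\to\mathcal D_{T^*}$, $z\in\mathbb D$. Then the following are equivalent: (i) $T$ is complex symmetric. (ii) There exists an anti-linear map $J:\mathcal D_T\to\mathcal D_{T^*}$ which is isometric, onto, and satisfies $$\Theta_T(z)=J\,\Theta_T(z)^*\,J\qquad\text{for all } z\in\mathbb D .$$ (iii) There exist a complex Hilbert space $\mathcal E$, a conjugation $J'$ on $\mathcal E$, and a pure contractive analytic function $\Theta:\mathbb D\to\mathcal L(\mathcal E)$, whose values $\Theta(z)$, $z\in\mathbb D$, are all $J'$-symmetric operators, such that $\Theta_T$ coincides with $\Theta$.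
   Context: $\mathbb D$ is the open unit disc; $\mathcal L(\mathcal H)$ (resp. $\mathcal L(\mathcal E,\mathcal E')$) denotes the bounded linear operators on $\mathcal H$ (resp. from $\mathcal E$ to $\mathcal E'$). A conjugation on a complex Hilbert space $\mathcal H$ is an anti-linear, isometric, involutive map $C:\mathcal H\to\mathcal H$; that is, $C^2=I$ and $\langle Cf,Cg\rangle=\langle g,f\rangle$ for all $f,g\in\mathcal H$. For a conjugation $C$ on $\mathcal H$, an operator $T\in\mathcal L(\mathcal H)$ is $C$-symmetric if $T=CT^*C$. $T$ is complex symmetric if it is $C$-symmetric for some conjugation $C$ on $\mathcal H$. For a contraction $T\in\mathcal L(\mathcal H)$, put $D_T=(I-T^*T)^{1/2}$, $D_{T^*}=(I-TT^* )^{1/2}$, and let the defect spaces be $\mathcal D_T=\overline{D_T\mathcal H}$ and $\mathcal D_{T^*}=\overline{D_{T^*}\mathcal H}$. The characteristic function of $T$ is the function which assigns to $\lambda\in\mathbb D$ the operator $\Theta_T(\lambda):\mathcal D_T\to\mathcal D_{T^*}$ given by $$\Theta_T(\lambda)=\bigl(-T+\lambda D_{T^*}(I-\lambda T^* )^{-1}D_T\bigr)\big|_{\mathcal D_T}.$$ A contractive analytic function is an analytic function $\Theta:\mathbb D\to\mathcal L(\mathcal E,\mathcal E_* )$ with $\|\Theta(z)\|\le1$ for all $z\in\mathbb D$, where $\mathcal E,\mathcal E_*$ are Hilbert spaces. It is pure if $\|\Theta(0)h\|<\|h\|$ for all $h\in\mathcal E$, $h\neq0$. Two contractive analytic functions $\Theta:\mathbb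 D\to\mathcal L(\mathcal E,\mathcal E_* )$ and $\Theta':\mathbb D\to\mathcal L(\mathcal E',\mathcal E'_* )$ coincide if there are unitary operators $U:\mathcal E\to\mathcal E'$ and $U_*:\mathcal E_*\to\mathcal E'_*$ (independent of $z$) such that $\Theta(z)=U_*^*\Theta'(z)U$ for all $z\in\mathbb D$. *)

theory Defs
  imports "HOL-Analysis.Analysis"
begin

section \<open>Complex Hilbert spaces\<close>

class complex_vector = real_vector +
  fixes scaleC :: "complex \<Rightarrow> 'a \<Rightarrow> 'a" (infixr "*\<^sub>C" 75)
  assumes scaleC_add_right: "a *\<^sub>C (x + y) = a *\<^sub>C x + a *\<^sub>C y"
    and scaleC_add_left: "(a + b) *\<^sub>C x = a *\<^sub>C x + b *\<^sub>C x"
    and scaleC_scaleC: "a *\<^sub>C (b *\<^sub>C x) = (a * b) *\<^sub>C x"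
    and scaleC_one: "1 *\<^sub>C x = x"
    and scaleR_scaleC: "r *\<^sub>R x = complex_of_real r *\<^sub>C x"

global_interpretation complex_vector: vector_space "scaleC :: complex \<Rightarrow> 'a \<Rightarrow> 'a::complex_vector"
  by unfold_locales (simp_all add: scaleC_add_right scaleC_add_left scaleC_scaleC scaleC_one)

text \<open>The inner product is linear in its first argument. The real inner product of the library
  is its real part; norm and topology are those induced by \<open>inner\<close> in the class
  \<^class>\<open>real_inner\<close>, which also makes the form positive definite.\<close>

class complex_inner = complex_vector + real_inner +
  fixes cinner :: "'a \<Rightarrow> 'a \<Rightarrow> complex"
  assumes cinner_commute: "cinner x y = cnj (cinner y x)"
    and cinner_add_left: "cinner (x + y) z = cinner x z + cinner y z"
    and cinner_scaleC_left: "cinner (c *\<^sub>C x) y = c * cinner x y"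
    and inner_eq_Re_cinner: "inner x y = Re (cinner x y)"

class chilbert_space = complex_inner + complete_space

instantiation complex :: chilbert_space
begin

definition "scaleC_complex (c::complex) (x::complex) = c * x"
definition "cinner_complex (x::complex) (y::complex) = x * cnj y"

instance
  by standard (simp_all add: scaleC_complex_def cinner_complex_def inner_complex_def
      algebra_simps scaleR_conv_of_real)

end


section \<open>Operators between closed subspaces\<close>

text \<open>Defect spaces are closed subspaces of the ambient space, so Hilbert spaces occur below as
  closed subspaces \<open>E\<close> of a type of class \<^class>\<open>chilbert_space\<close> (with \<open>E = UNIV\<close> for the whole
  space). A map with domain \<open>E\<close> is a total HOL function of which only the values on \<open>E\<close> matter;
  equality of such maps is equality at every point of \<open>E\<close>.\<close>

definition closed_csubspace :: "'a::chilbert_space set \<Rightarrow> bool" where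
  "closed_csubspace E \<longleftrightarrow> complex_vector.subspace E \<and> closed E"

definition clinear_on :: "'a::chilbert_space set \<Rightarrow> ('a \<Rightarrow> 'b::chilbert_space) \<Rightarrow> bool" where
  "clinear_on E A \<longleftrightarrow> (\<forall>x\<in>E. \<forall>y\<in>E. A (x + y) = A x + A y) \<and> (\<forall>c. \<forall>x\<in>E. A (c *\<^sub>C x) = c *\<^sub>C A x)"

definition antilinear_on :: "'a::chilbert_space set \<Rightarrow> ('a \<Rightarrow> 'b::chilbert_space) \<Rightarrow> bool" where
  "antilinear_on E A \<longleftrightarrow> (\<forall>x\<in>E. \<forall>y\<in>E. A (x + y) = A x + A y) \<and> (\<forall>c. \<forall>x\<in>E. A (c *\<^sub>C x) = cnj c *\<^sub>C A x)"

definition bounded_op :: "'a::chilbert_space set \<Rightarrow> 'b::chilbert_space set \<Rightarrow> ('a \<Rightarrow> 'b) \<Rightarrow> bool" where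
  "bounded_op E F A \<longleftrightarrow> A ` E \<subseteq> F \<and> clinear_on E A \<and> (\<exists>K. \<forall>x\<in>E. norm (A x) \<le> K * norm x)"

definition contraction_on :: "'a::chilbert_space set \<Rightarrow> ('a \<Rightarrow> 'b::chilbert_space) \<Rightarrow> bool" where
  "contraction_on E A \<longleftrightarrow> (\<forall>x\<in>E. norm (A x) \<le> norm x)"

text \<open>For \<open>A\<close> bounded from \<open>E\<close> to \<open>F\<close>, \<open>adj_on E A\<close> is the Hilbert space adjoint from \<open>F\<close> to \<open>E\<close>;
  its value at a point of \<open>F\<close> does not depend on \<open>F\<close>.\<close>

definition adj_on :: "'a::chilbert_space set \<Rightarrow> ('a \<Rightarrow> 'b::chilbert_space) \<Rightarrow> 'b \<Rightarrow> 'a" where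
  "adj_on E A y = (THE x. x \<in> E \<and> (\<forall>u\<in>E. cinner (A u) y = cinner u x))"

definition unitary_on :: "'a::chilbert_space set \<Rightarrow> 'b::chilbert_space set \<Rightarrow> ('a \<Rightarrow> 'b) \<Rightarrow> bool" where
  "unitary_on E F U \<longleftrightarrow> clinear_on E U \<and> U ` E = F \<and> (\<forall>x\<in>E. \<forall>y\<in>E. cinner (U x) (U y) = cinner x y)"


section \<open>Complex symmetric operators\<close>

definition conjugation_on :: "'a::chilbert_space set \<Rightarrow> ('a \<Rightarrow> 'a) \<Rightarrow> bool" where
  "conjugation_on E C \<longleftrightarrow> C ` E \<subseteq> E \<and> antilinear_on E C \<and> (\<forall>x\<in>E. C (C x) = x)
     \<and> (\<forall>x\<in>E. \<forall>y\<in>E. cinner (C x) (C y) = cinner y x)"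

definition symmetric_on :: "'a::chilbert_space set \<Rightarrow> ('a \<Rightarrow> 'a) \<Rightarrow> ('a \<Rightarrow> 'a) \<Rightarrow> bool" where
  "symmetric_on E C A \<longleftrightarrow> (\<forall>x\<in>E. A x = C (adj_on E A (C x)))"

definition complex_symmetric :: "('h::chilbert_space \<Rightarrow> 'h) \<Rightarrow> bool" where
  "complex_symmetric T \<longleftrightarrow> (\<exists>C. conjugation_on UNIV C \<and> symmetric_on UNIV C T)"


section \<open>Defect operators and the characteristic function\<close>

definition positive_op :: "('h::chilbert_space \<Rightarrow> 'h) \<Rightarrow> bool" where
  "positive_op S \<longleftrightarrow> bounded_op UNIV UNIV S \<and> (\<forall>x. cinner (S x) x \<in> \<real>\<^sub>\<ge>\<^sub>0)"

definition op_sqrt :: "('h::chilbert_space \<Rightarrow> 'h) \<Rightarrow> 'h \<Rightarrow> 'h" where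
  "op_sqrt A = (THE S. positive_op S \<and> S \<circ> S = A)"

abbreviation adj :: "('h::chilbert_space \<Rightarrow> 'h) \<Rightarrow> 'h \<Rightarrow> 'h" where
  "adj \<equiv> adj_on UNIV"

definition defect_op :: "('h::chilbert_space \<Rightarrow> 'h) \<Rightarrow> 'h \<Rightarrow> 'h" where
  "defect_op T = op_sqrt (\<lambda>x. x - adj T (T x))"

definition defect_op_star :: "('h::chilbert_space \<Rightarrow> 'h) \<Rightarrow> 'h \<Rightarrow> 'h" where
  "defect_op_star T = op_sqrt (\<lambda>x. x - T (adj T x))"

definition defect_space :: "('h::chilbert_space \<Rightarrow> 'h) \<Rightarrow> 'h set" where
  "defect_space T = closure (range (defect_op T))"

definition defect_space_star :: "('h::chilbert_space \<Rightarrow> 'h) \<Rightarrow> 'h set" where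
  "defect_space_star T = closure (range (defect_op_star T))"

text \<open>To be read as a map from \<^term>\<open>defect_space T\<close> to \<^term>\<open>defect_space_star T\<close>, for \<open>cmod z < 1\<close>.\<close>

definition char_fun :: "('h::chilbert_space \<Rightarrow> 'h) \<Rightarrow> complex \<Rightarrow> 'h \<Rightarrow> 'h" where
  "char_fun T z x = - T x + z *\<^sub>C defect_op_star T (inv (\<lambda>y. y - z *\<^sub>C adj T y) (defect_op T x))"


section \<open>Contractive analytic functions on the unit disc\<close>

text \<open>Analyticity is complex differentiability at every point with respect to the operator norm.\<close>

definition analytic_op_fun ::
  "'a::chilbert_space set \<Rightarrow> 'b::chilbert_space set \<Rightarrow> (complex \<Rightarrow> 'a \<Rightarrow> 'b) \<Rightarrow> bool" where
  "analytic_op_fun E F \<Theta> \<longleftrightarrow>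
     (\<forall>z\<in>ball 0 1. bounded_op E F (\<Theta> z)) \<and>
     (\<forall>z\<in>ball 0 1. \<exists>D. bounded_op E F D \<and>
        (\<forall>\<epsilon>>0. \<forall>\<^sub>F w in at z. \<forall>x\<in>E.
           norm ((1 / (w - z)) *\<^sub>C (\<Theta> w x - \<Theta> z x) - D x) \<le> \<epsilon> * norm x))"

definition contractive_analytic ::
  "'a::chilbert_space set \<Rightarrow> 'b::chilbert_space set \<Rightarrow> (complex \<Rightarrow> 'a \<Rightarrow> 'b) \<Rightarrow> bool" where
  "contractive_analytic E F \<Theta> \<longleftrightarrow>
     analytic_op_fun E F \<Theta> \<and> (\<forall>z\<in>ball 0 1. contraction_on E (\<Theta> z))"

definition pure_on :: "'a::chilbert_space set \<Rightarrow> (complex \<Rightarrow> 'a \<Rightarrow> 'b::chilbert_space) \<Rightarrow> bool" where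
  "pure_on E \<Theta> \<longleftrightarrow> (\<forall>h\<in>E. h \<noteq> 0 \<longrightarrow> norm (\<Theta> 0 h) < norm h)"

definition coincide ::
  "'a::chilbert_space set \<Rightarrow> 'b::chilbert_space set \<Rightarrow> (complex \<Rightarrow> 'a \<Rightarrow> 'b) \<Rightarrow>
   'c::chilbert_space set \<Rightarrow> 'd::chilbert_space set \<Rightarrow> (complex \<Rightarrow> 'c \<Rightarrow> 'd) \<Rightarrow> bool" where
  "coincide E F \<Theta> E' F' \<Theta>' \<longleftrightarrow>
     (\<exists>U V. unitary_on E E' U \<and> unitary_on F F' V \<and>
        (\<forall>z\<in>ball 0 1. \<forall>x\<in>E. \<Theta> z x = adj_on F V (\<Theta>' z (U x))))"

text \<open>HOL cannot quantify existentially over types, so the type \<open>'e\<close> in which the Hilbert space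
  \<open>E\<close> lives is a parameter. For \<open>E\<close> to range over all complex Hilbert spaces, a statement that
  assumes the property must allow an arbitrary \<open>'e\<close>, and one that concludes it must name a type;
  the type of the space on which \<open>T\<close> acts always suffices.\<close>

definition coincides_with_symmetric :: "'e::chilbert_space itself \<Rightarrow> ('h::chilbert_space \<Rightarrow> 'h) \<Rightarrow> bool" where
  "coincides_with_symmetric _ T \<longleftrightarrow>
     (\<exists>(E :: 'e set) J' \<Theta>. closed_csubspace E \<and> conjugation_on E J' \<and>
        contractive_analytic E E \<Theta> \<and> pure_on E \<Theta> \<and>
        (\<forall>z\<in>ball 0 1. symmetric_on E J' (\<Theta> z)) \<and>
        coincide (defect_space T) (defect_space_star T) (char_fun T) E E \<Theta>)"

end

theory Submission
  imports Defs
begin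

text \<open>Write \<open>D\<close>, \<open>D\<^sub>*\<close> for the defect operators of \<open>T\<close>. The characteristic function has the Taylor
  coefficients \<open>\<Theta>\<^sub>0 = - T\<close> and \<open>\<Theta>\<^sub>k\<^sub>+\<^sub>1 = D\<^sub>* T\<^sup>*\<^sup>k D\<close>. For an antiunitary map \<open>J\<close> between the
  defect spaces, \<open>\<Theta>(z) = J \<Theta>(z)\<^sup>* J\<close> says that the bilinear form \<open>\<langle>\<Theta>(z) u, J x\<rangle>\<close> is symmetric in
  \<open>u\<close> and \<open>x\<close> (\<open>adj_symmetric_iff\<close>); comparing power series, this holds on the whole disc if and
  only if every form \<open>\<langle>\<Theta>\<^sub>k u, J x\<rangle>\<close> is symmetric (\<open>\<Theta>_symmetric_iff\<close>).

  If \<open>C\<close> is a conjugation with \<open>C T = T\<^sup>* C\<close>, then \<open>C\<close> carries \<open>T\<^sup>* T\<close> to \<open>T T\<^sup>*\<close> and hence \<open>D\<close> to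
  \<open>D\<^sub>*\<close> (\<open>root_intertwine\<close>), so its restriction to the defect space of \<open>T\<close> is such a \<open>J\<close>
  (\<open>conjugation_imp_coef_symmetric\<close>).

  Conversely, given \<open>J\<close>, let \<open>C\<close> exchange \<open>T\<^sup>n D\<^sub>* J x\<close> and \<open>T\<^sup>*\<^sup>n D x\<close>. Because
  \<open>T\<^sup>* T = I - D\<^sup>2\<close> and \<open>T T\<^sup>* = I - D\<^sub>*\<^sup>2\<close>, all inner products among these vectors are expressed by
  the coefficients \<open>\<Theta>\<^sub>k\<close>, and the symmetry of the coefficients says precisely that the exchange is
  compatible with an antiunitary map (\<open>generator_gram\<close>, \<open>generator_gram_mixed\<close>). What is orthogonal
  to all of these vectors is a reducing subspace on which \<open>T\<close> is unitary. By Zorn's lemma it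
  splits into cyclic reducing subspaces, and on the one generated by \<open>s\<close> let \<open>C\<close> exchange \<open>T\<^sup>n s\<close>
  and \<open>T\<^sup>*\<^sup>n s\<close>. An exchange of this kind on a total family extends to a conjugation
  (\<open>conjugation_from_pairs\<close>), and \<open>C T = T\<^sup>* C\<close> is checked on the generators
  (\<open>conjugation_from_symmetric_coef\<close>).

  For the symmetric models, a unitary change of the two defect spaces turns \<open>J\<close> into a conjugation
  and back. Any conjugation \<open>C\<close> of the defect space of \<open>T\<close> gives the unitary map \<open>V = C J\<^sup>-\<^sup>1\<close> and
  the \<open>C\<close>-symmetric function \<open>V \<Theta>(z)\<close>; and if \<open>\<Theta>(z) = V\<^sup>* \<Psi>(z) U\<close> with \<open>C\<close>-symmetric \<open>\<Psi>(z)\<close>,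
  then \<open>J = V\<^sup>* C U\<close> has the required symmetry.\<close>


section \<open>Complex inner products\<close>

instance chilbert_space \<subseteq> banach ..

lemma cinner_add_right: "cinner x (y + z) = cinner x y + cinner x (z::'a::complex_inner)"
  by (metis cinner_add_left cinner_commute complex_cnj_add)

lemma cinner_scaleC_right: "cinner x (c *\<^sub>C y) = cnj c * cinner x (y::'a::complex_inner)"
  by (metis cinner_commute cinner_scaleC_left complex_cnj_mult)

lemma cinner_scaleR_left: "cinner (r *\<^sub>R x) y = of_real r * cinner x (y::'a::complex_inner)"
  by (simp add: scaleR_scaleC cinner_scaleC_left)

lemma cinner_scaleR_right: "cinner x (r *\<^sub>R y) = of_real r * cinner x (y::'a::complex_inner)"
  by (simp add: scaleR_scaleC cinner_scaleC_right)

lemma cinner_zero_left [simp]: "cinner 0 (y::'a::complex_inner) = 0"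
  using cinner_scaleR_left[of 0 0 y] by simp

lemma cinner_zero_right [simp]: "cinner (y::'a::complex_inner) 0 = 0"
  using cinner_scaleR_right[of y 0 0] by simp

lemma cinner_minus_left: "cinner (- x) y = - cinner x (y::'a::complex_inner)"
  using cinner_scaleR_left[of "-1" x y] by simp

lemma cinner_minus_right: "cinner x (- y) = - cinner x (y::'a::complex_inner)"
  using cinner_scaleR_right[of x "-1" y] by simp

lemma cinner_diff_left: "cinner (x - y) z = cinner x z - cinner y (z::'a::complex_inner)"
  using cinner_add_left[of x "- y" z] by (simp add: cinner_minus_left)

lemma cinner_diff_right: "cinner x (y - z) = cinner x y - cinner x (z::'a::complex_inner)"
  using cinner_add_right[of x y "- z"] by (simp add: cinner_minus_right)

lemmas cinner_simps = cinner_add_left cinner_add_right cinner_diff_left cinner_diff_right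
  cinner_minus_left cinner_minus_right cinner_scaleC_left cinner_scaleC_right
  cinner_scaleR_left cinner_scaleR_right

lemma scaleC_minus1: "- x = (-1) *\<^sub>C (x::'a::complex_vector)"
  using scaleR_scaleC[of "-1" x] by simp

lemma cinner_self: "cinner x x = of_real ((norm (x::'a::complex_inner))\<^sup>2)"
proof -
  have "Re (cinner x x) = (norm x)\<^sup>2"
    by (metis inner_eq_Re_cinner power2_norm_eq_inner)
  moreover have "Im (cinner x x) = 0"
    by (metis Reals_cnj_iff cinner_commute complex_is_Real_iff)
  ultimately show ?thesis by (simp add: complex_eq_iff)
qed

lemma cinner_self_eq_0 [simp]: "cinner x x = 0 \<longleftrightarrow> x = (0::'a::complex_inner)"
  by (simp add: cinner_self)

lemma norm_scaleC: "norm (c *\<^sub>C x) = cmod c * norm (x::'a::complex_inner)"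
proof -
  have "complex_of_real ((norm (c *\<^sub>C x))\<^sup>2) = of_real ((cmod c * norm x)\<^sup>2)"
    unfolding cinner_self[symmetric] cinner_simps
    by (simp add: cinner_self power_mult_distrib complex_norm_square del: of_real_power)
  then have "(norm (c *\<^sub>C x))\<^sup>2 = (cmod c * norm x)\<^sup>2"
    by (simp only: of_real_eq_iff)
  then show ?thesis by (simp add: power2_eq_iff_nonneg)
qed

lemma cmod_cinner_le: "cmod (cinner x y) \<le> norm x * norm (y::'a::complex_inner)"
proof (cases "cinner x y = 0")
  case False
  \<comment> \<open>rotate \<open>x\<close> by the phase of the inner product, and use the real Cauchy--Schwarz inequality\<close>
  define c where "c = cnj (cinner x y) / of_real (cmod (cinner x y))"
  have c: "cmod c = 1" using False by (simp add: c_def norm_divide)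
  have "c * cinner x y = of_real (cmod (cinner x y))"
    using False by (simp add: c_def mult.commute[of "cnj _"] flip: complex_norm_square)
      (simp add: power2_eq_square)
  then have "cmod (cinner x y) = inner (c *\<^sub>C x) y"
    by (simp add: inner_eq_Re_cinner cinner_simps)
  also have "\<dots> \<le> norm (c *\<^sub>C x) * norm y" by (rule norm_cauchy_schwarz)
  finally show ?thesis using c by (simp add: norm_scaleC)
qed simp

lemma bounded_bilinear_cinner:
  "bounded_bilinear (cinner :: 'a::complex_inner \<Rightarrow> 'a \<Rightarrow> complex)"
  by standard (auto simp: cinner_simps scaleR_conv_of_real intro!: exI[of _ 1] cmod_cinner_le)

lemmas tendsto_cinner [tendsto_intros] = bounded_bilinear.tendsto[OF bounded_bilinear_cinner]

lemma bounded_linear_scaleC: "bounded_linear (\<lambda>x::'a::complex_inner. c *\<^sub>C x)"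
  by standard (auto simp: norm_scaleC scaleC_add_right scaleR_scaleC scaleC_scaleC mult.commute
      intro!: exI[of _ "cmod c"])

lemma norm_add_sq:
  "(norm (x + y))\<^sup>2 = (norm x)\<^sup>2 + 2 * Re (cinner x y) + (norm (y::'a::complex_inner))\<^sup>2"
  by (simp add: power2_norm_eq_inner inner_add_left inner_add_right inner_commute
      inner_eq_Re_cinner[symmetric])

lemma eq_if_cinner_eq:
  fixes x y :: "'a::complex_inner"
  assumes "\<And>u. cinner u x = cinner u y"
  shows "x = y"
  using assms[of "x - y"] cinner_self_eq_0[of "x - y"] by (simp add: cinner_diff_right)


section \<open>Closed subspaces, the Riesz representation theorem and adjoints\<close>

lemma closed_csubspaceD:
  assumes "closed_csubspace E"
  shows "closed E" "0 \<in> E" "x \<in> E \<Longrightarrow> y \<in> E \<Longrightarrow> x + y \<in> E" "x \<in> E \<Longrightarrow> c *\<^sub>C x \<in> E"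
    "x \<in> E \<Longrightarrow> y \<in> E \<Longrightarrow> x - y \<in> E" "x \<in> E \<Longrightarrow> r *\<^sub>R x \<in> E"
  using assms unfolding closed_csubspace_def scaleR_scaleC
  by (auto simp: complex_vector.subspace_0 complex_vector.subspace_add
      complex_vector.subspace_scale complex_vector.subspace_diff)

lemma closed_csubspace_UNIV [simp]: "closed_csubspace UNIV"
  by (simp add: closed_csubspace_def)

lemma closed_csubspace_closure:
  assumes "complex_vector.subspace E"
  shows "closed_csubspace (closure E)"
  unfolding closed_csubspace_def complex_vector.subspace_def
proof (intro conjI ballI allI)
  show "0 \<in> closure E"
    using assms closure_subset complex_vector.subspace_0 by blast
  show "x + y \<in> closure E" if "x \<in> closure E" "y \<in> closure E" for x y
  proof -
    obtain f g where "\<And>n. f n \<in> E" "f \<longlonglongrightarrow> x" "\<And>n. g n \<in> E" "g \<longlonglongrightarrow> y"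
      using \<open>x \<in> closure E\<close> \<open>y \<in> closure E\<close> by (meson closure_sequential)
    then have "(\<lambda>n. f n + g n) \<longlonglongrightarrow> x + y" "\<And>n. f n + g n \<in> E"
      using assms by (auto intro: tendsto_add complex_vector.subspace_add)
    then show ?thesis unfolding closure_sequential by (intro exI[of _ "\<lambda>n. f n + g n"]) auto
  qed
  show "c *\<^sub>C x \<in> closure E" if "x \<in> closure E" for c x
  proof -
    obtain f where "\<And>n. f n \<in> E" "f \<longlonglongrightarrow> x"
      using \<open>x \<in> closure E\<close> by (meson closure_sequential)
    then have "(\<lambda>n. c *\<^sub>C f n) \<longlonglongrightarrow> c *\<^sub>C x" "\<And>n. c *\<^sub>C f n \<in> E"
      using assms by (auto intro: bounded_linear.tendsto[OF bounded_linear_scaleC]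
          complex_vector.subspace_scale)
    then show ?thesis unfolding closure_sequential by (intro exI[of _ "\<lambda>n. c *\<^sub>C f n"]) auto
  qed
qed simp

text \<open>At \<open>t = - a / (b + 1)\<close> the linear term outweighs the quadratic one.\<close>

lemma linear_term_eq_0:
  fixes a b :: real
  assumes nonneg: "\<And>t. 0 \<le> 2 * t * a + t\<^sup>2 * b" and b: "0 \<le> b"
  shows "a = 0"
proof (rule ccontr)
  assume "a \<noteq> 0"
  have sq: "b * (a / (b + 1))\<^sup>2 \<le> (b + 1) * (a / (b + 1))\<^sup>2"
    by (intro mult_right_mono) simp_all
  have "(b + 1) * (a / (b + 1))\<^sup>2 = a * a / (b + 1)" using b by (simp add: power2_eq_square)
  moreover have "0 \<le> - 2 * (a * a / (b + 1)) + b * (a / (b + 1))\<^sup>2"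
    using nonneg[of "- (a / (b + 1))"] by (simp add: mult.commute)
  ultimately have "a * a / (b + 1) \<le> 0" using sq by linarith
  moreover have "0 < a * a / (b + 1)"
    using \<open>a \<noteq> 0\<close> b by (intro divide_pos_pos) (auto simp: zero_less_mult_iff)
  ultimately show False by simp
qed

text \<open>The representing vector minimises \<open>\<parallel>u\<parallel>\<^sup>2 - 2 g(u)\<close> over \<open>E\<close>: the parallelogram law makes every
  minimising sequence Cauchy, and the first variation vanishes at its limit.\<close>

lemma riesz_on_real:
  fixes E :: "'a::chilbert_space set" and g :: "'a \<Rightarrow> real"
  assumes E: "closed_csubspace E"
    and add: "\<And>u v. u \<in> E \<Longrightarrow> v \<in> E \<Longrightarrow> g (u + v) = g u + g v"
    and scale: "\<And>r u. u \<in> E \<Longrightarrow> g (r *\<^sub>R u) = r * g u"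
    and bdd: "\<And>u. u \<in> E \<Longrightarrow> \<bar>g u\<bar> \<le> K * norm u"
  shows "\<exists>a\<in>E. \<forall>u\<in>E. g u = inner u a"
proof -
  note E' = closed_csubspaceD[OF E]
  define \<phi> where "\<phi> u = (norm u)\<^sup>2 - 2 * g u" for u
  define m where "m = (INF u\<in>E. \<phi> u)"
  have lower: "- K\<^sup>2 \<le> \<phi> u" if "u \<in> E" for u
  proof -
    have "0 \<le> (norm u - K)\<^sup>2" by simp
    then show ?thesis using bdd[OF that] by (simp add: \<phi>_def power2_eq_square algebra_simps)
  qed
  have bdd_below: "bdd_below (\<phi> ` E)" using lower by (auto intro!: bdd_belowI2)
  have m_le: "m \<le> \<phi> u" if "u \<in> E" for u
    unfolding m_def by (rule cINF_lower[OF bdd_below that])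
  have "\<exists>u\<in>E. \<phi> u < m + 1 / Suc n" for n
    using cINF_less_iff[of E \<phi> "m + 1 / Suc n"] bdd_below E'(2) unfolding m_def by auto
  then obtain f where fE: "\<And>n. f n \<in> E" and fm: "\<And>n. \<phi> (f n) < m + 1 / Suc n" by metis
  have dist_le: "(norm (u - v))\<^sup>2 \<le> 2 * (\<phi> u - m) + 2 * (\<phi> v - m)" if "u \<in> E" "v \<in> E" for u v
  proof -
    have mid: "(1/2) *\<^sub>R (u + v) \<in> E" using that E' by auto
    have "(norm ((1/2) *\<^sub>R (u + v)))\<^sup>2 = (norm (u + v))\<^sup>2 / 4"
      by (simp only: norm_scaleR power_mult_distrib) (simp add: power2_eq_square)
    moreover have "g ((1/2) *\<^sub>R (u + v)) = (g u + g v) / 2"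
      using that E' by (simp only: scale add)
    ultimately have "\<phi> ((1/2) *\<^sub>R (u + v)) = (norm (u + v))\<^sup>2 / 4 - (g u + g v)"
      by (simp only: \<phi>_def) (simp add: field_simps)
    moreover have "(norm (u + v))\<^sup>2 + (norm (u - v))\<^sup>2 = 2 * (norm u)\<^sup>2 + 2 * (norm v)\<^sup>2"
      by (simp add: power2_norm_eq_inner inner_simps inner_commute)
    ultimately show ?thesis using m_le[OF mid] by (simp add: \<phi>_def)
  qed
  have "Cauchy f"
  proof (rule metric_CauchyI)
    fix e :: real assume "0 < e"
    obtain N where N: "4 / real (Suc N) < e\<^sup>2"
    proof -
      obtain N where "4 / e\<^sup>2 < real N" using reals_Archimedean2 by blast
      then have "4 / e\<^sup>2 < real (Suc N)" by simp
      then show ?thesis using \<open>0 < e\<close> by (intro that[of N]) (simp add: field_simps)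
    qed
    have "dist (f i) (f j) < e" if "N \<le> i" "N \<le> j" for i j
    proof -
      have *: "\<phi> (f k) - m \<le> 1 / Suc N" if "N \<le> k" for k
      proof -
        have "1 / real (Suc k) \<le> 1 / Suc N" using that by (simp add: frac_le)
        then show ?thesis using fm[of k] by linarith
      qed
      have "(norm (f i - f j))\<^sup>2 \<le> 4 / Suc N"
        using dist_le[OF fE fE, of i j] *[OF that(1)] *[OF that(2)] by simp
      then have "(norm (f i - f j))\<^sup>2 < e\<^sup>2" using N by linarith
      then show ?thesis using \<open>0 < e\<close> by (simp add: dist_norm power2_less_imp_less)
    qed
    then show "\<exists>N. \<forall>i\<ge>N. \<forall>j\<ge>N. dist (f i) (f j) < e" by blast
  qed
  then obtain a where a: "f \<longlonglongrightarrow> a" using Cauchy_convergent_iff convergent_def by blast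
  have aE: "a \<in> E" using E'(1) fE a closed_sequentially by blast
  have \<phi>_a: "\<phi> a \<le> m"
  proof -
    have "(\<lambda>n. g (f n)) \<longlonglongrightarrow> g a"
    proof (rule LIM_zero_cancel, rule Lim_null_comparison)
      have "g (f n) - g a = g (f n - a)" for n
        using add[of "f n - a" a] fE aE E' by simp
      then show "\<forall>\<^sub>F n in sequentially. norm (g (f n) - g a) \<le> K * norm (f n - a)"
        using bdd fE aE E' by auto
      show "(\<lambda>n. K * norm (f n - a)) \<longlonglongrightarrow> 0"
        using a by (intro tendsto_mult_right_zero tendsto_norm_zero) (simp add: LIM_zero)
    qed
    then have "(\<lambda>n. \<phi> (f n)) \<longlonglongrightarrow> \<phi> a"
      unfolding \<phi>_def by (intro tendsto_intros a)
    moreover have "(\<lambda>n. m + 1 / real (Suc n)) \<longlonglongrightarrow> m + 0"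
      by (intro tendsto_intros LIMSEQ_Suc[OF lim_1_over_n])
    ultimately show ?thesis
      using LIMSEQ_le[of "\<lambda>n. \<phi> (f n)" "\<phi> a" "\<lambda>n. m + 1 / real (Suc n)" m] fm less_imp_le by auto
  qed
  have "g u = inner u a" if u: "u \<in> E" for u
  proof -
    define d where "d = inner u a - g u"
    have "0 \<le> 2 * t * d + t\<^sup>2 * (norm u)\<^sup>2" for t
    proof -
      have "\<phi> a \<le> \<phi> (a + t *\<^sub>R u)"
        using \<phi>_a m_le[of "a + t *\<^sub>R u"] aE u E' by fastforce
      moreover have "g (a + t *\<^sub>R u) = g a + t * g u" using aE u E' by (simp add: add scale)
      moreover have "(norm (a + t *\<^sub>R u))\<^sup>2 = (norm a)\<^sup>2 + 2 * t * inner u a + t\<^sup>2 * (norm u)\<^sup>2"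
        unfolding power2_norm_eq_inner
        by (simp add: inner_simps inner_commute power2_eq_square algebra_simps)
      ultimately show ?thesis
        by (simp add: \<phi>_def d_def algebra_simps)
    qed
    then have "d = 0" by (rule linear_term_eq_0) simp
    then show ?thesis by (simp add: d_def)
  qed
  with aE show ?thesis by blast
qed

text \<open>The real theorem yields the real part; the imaginary part follows from \<open>f (\<i> u) = \<i> f u\<close>.\<close>

lemma riesz_on:
  fixes E :: "'a::chilbert_space set" and f :: "'a \<Rightarrow> complex"
  assumes E: "closed_csubspace E"
    and add: "\<And>u v. u \<in> E \<Longrightarrow> v \<in> E \<Longrightarrow> f (u + v) = f u + f v"
    and scale: "\<And>c u. u \<in> E \<Longrightarrow> f (c *\<^sub>C u) = c * f u"
    and bdd: "\<And>u. u \<in> E \<Longrightarrow> cmod (f u) \<le> K * norm u"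
  shows "\<exists>a\<in>E. \<forall>u\<in>E. f u = cinner u a"
proof -
  have "\<exists>a\<in>E. \<forall>u\<in>E. Re (f u) = inner u a"
  proof (rule riesz_on_real[OF E])
    show "\<bar>Re (f u)\<bar> \<le> K * norm u" if "u \<in> E" for u
      using bdd[OF that] abs_Re_le_cmod[of "f u"] by linarith
  qed (simp_all add: add scale scaleR_scaleC)
  then obtain a where a: "a \<in> E" "\<And>u. u \<in> E \<Longrightarrow> Re (f u) = Re (cinner u a)"
    by (auto simp: inner_eq_Re_cinner)
  have "f u = cinner u a" if "u \<in> E" for u
  proof (rule complex_eqI)
    show "Re (f u) = Re (cinner u a)" using a that by blast
    have "Re (f (\<i> *\<^sub>C u)) = Re (cinner (\<i> *\<^sub>C u) a)"
      using a that closed_csubspaceD(4)[OF E] by blast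
    then show "Im (f u) = Im (cinner u a)" using that by (simp add: scale cinner_simps)
  qed
  with a(1) show ?thesis by blast
qed

text \<open>The projection of \<open>x\<close> is the Riesz vector of the functional \<open>u \<mapsto> \<langle>u, x\<rangle>\<close> on \<open>E\<close>.\<close>

lemma orthogonal_projection:
  fixes E :: "'a::chilbert_space set"
  assumes "closed_csubspace E"
  obtains a where "a \<in> E" "\<And>u. u \<in> E \<Longrightarrow> cinner u (x - a) = 0"
proof -
  have "\<exists>a\<in>E. \<forall>u\<in>E. cinner u x = cinner u a"
    by (rule riesz_on[OF assms, of _ "norm x"])
       (simp_all add: cinner_simps cmod_cinner_le mult.commute[of "norm x"])
  then show ?thesis using that by (auto simp: cinner_diff_right)
qed

lemma bounded_opD:
  assumes "bounded_op E F A"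
  shows "x \<in> E \<Longrightarrow> A x \<in> F" "x \<in> E \<Longrightarrow> y \<in> E \<Longrightarrow> A (x + y) = A x + A y"
    "x \<in> E \<Longrightarrow> A (c *\<^sub>C x) = c *\<^sub>C A x"
  using assms unfolding bounded_op_def clinear_on_def by auto

lemma bounded_op_bound: "bounded_op E F A \<Longrightarrow> \<exists>K. \<forall>x\<in>E. norm (A x) \<le> K * norm x"
  by (simp add: bounded_op_def)

lemma bounded_op_UNIV_linear:
  assumes "bounded_op UNIV UNIV A"
  shows "bounded_linear A"
proof -
  obtain K where K: "\<And>x. norm (A x) \<le> K * norm x"
    using bounded_op_bound[OF assms] by auto
  show ?thesis
  proof (rule bounded_linear_intro)
    show "norm (A x) \<le> norm x * K" for x using K[of x] by (simp add: mult.commute)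
  qed (simp_all add: scaleR_scaleC bounded_opD[OF assms])
qed

lemma adj_on_eq:
  fixes E :: "'a::chilbert_space set"
  assumes E: "closed_csubspace E" and "a \<in> E" and a: "\<And>u. u \<in> E \<Longrightarrow> cinner (A u) y = cinner u a"
  shows "adj_on E A y = a"
  unfolding adj_on_def
proof (rule the_equality)
  fix x assume x: "x \<in> E \<and> (\<forall>u\<in>E. cinner (A u) y = cinner u x)"
  then have "x - a \<in> E" using \<open>a \<in> E\<close> closed_csubspaceD(5)[OF E] by blast
  then have "cinner (x - a) x = cinner (x - a) a" using x a by metis
  then show "x = a" using cinner_self_eq_0[of "x - a"] by (simp add: cinner_diff_right)
qed (use assms in auto)

lemma adj_on_ex:
  fixes E :: "'a::chilbert_space set"
  assumes E: "closed_csubspace E" and A: "bounded_op E F A"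
  shows "\<exists>a\<in>E. \<forall>u\<in>E. cinner (A u) y = cinner u a"
proof -
  obtain K where K: "\<And>x. x \<in> E \<Longrightarrow> norm (A x) \<le> K * norm x" using bounded_op_bound[OF A] by blast
  show ?thesis
  proof (rule riesz_on[OF E, of _ "K * norm y"])
    fix u assume "u \<in> E"
    have "cmod (cinner (A u) y) \<le> norm (A u) * norm y" by (rule cmod_cinner_le)
    also have "\<dots> \<le> (K * norm u) * norm y" using K[OF \<open>u \<in> E\<close>] by (simp add: mult_right_mono)
    finally show "cmod (cinner (A u) y) \<le> K * norm y * norm u" by (simp add: ac_simps)
  qed (simp_all add: bounded_opD[OF A] cinner_simps)
qed

lemma adj_on_in: "closed_csubspace E \<Longrightarrow> bounded_op E F A \<Longrightarrow> adj_on E A y \<in> E"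
  using adj_on_ex[of E F A y] adj_on_eq[of E _ A y] by metis

lemma cinner_adj_on:
  "closed_csubspace E \<Longrightarrow> bounded_op E F A \<Longrightarrow> u \<in> E \<Longrightarrow> cinner (A u) y = cinner u (adj_on E A y)"
  using adj_on_ex[of E F A y] adj_on_eq[of E _ A y] by metis

lemma bounded_op_UNIV_I:
  assumes "\<And>x y. A (x + y) = A x + A y" "\<And>c x. A (c *\<^sub>C x) = c *\<^sub>C A x"
    "\<And>x. norm (A x) \<le> K * norm x"
  shows "bounded_op UNIV UNIV A"
  using assms unfolding bounded_op_def clinear_on_def by auto

lemma adj_contraction:
  assumes T: "bounded_op UNIV UNIV T" and le: "\<And>x. norm (T x) \<le> norm x"
  shows "bounded_op UNIV UNIV (adj T)" "norm (adj T x) \<le> norm x"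
proof -
  have adj: "cinner (T u) y = cinner u (adj T y)" for u y
    using cinner_adj_on[OF _ T] by simp
  have bound: "norm (adj T x) \<le> norm x" for x
  proof (cases "adj T x = 0")
    case False
    have "(norm (adj T x))\<^sup>2 = cmod (cinner (T (adj T x)) x)"
      unfolding adj by (simp add: cinner_self norm_power flip: of_real_power)
    also have "\<dots> \<le> norm (adj T x) * norm x"
      using cmod_cinner_le[of "T (adj T x)" x] le[of "adj T x"]
      by (meson mult_right_mono norm_ge_zero order_trans)
    finally show ?thesis using False by (simp add: power2_eq_square)
  qed simp
  then show "norm (adj T x) \<le> norm x" .
  show "bounded_op UNIV UNIV (adj T)"
  proof (rule bounded_op_UNIV_I[where K=1])
    show "adj T (x + y) = adj T x + adj T y" for x y
      by (rule eq_if_cinner_eq) (simp add: cinner_add_right flip: adj)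
    show "adj T (c *\<^sub>C x) = c *\<^sub>C adj T x" for c x
      by (rule eq_if_cinner_eq) (simp add: cinner_scaleC_right flip: adj)
  qed (simp add: bound)
qed


section \<open>Square roots of operators\<close>

text \<open>For a self-adjoint contraction \<open>B\<close> the fixed point equation \<open>Y = (B + Y\<^sup>2) / 2\<close> says
  \<open>(I - Y)\<^sup>2 = I - B\<close>.\<close>

primrec sqrt_iter :: "('a::real_vector \<Rightarrow> 'a) \<Rightarrow> nat \<Rightarrow> 'a \<Rightarrow> 'a" where
  "sqrt_iter B 0 = (\<lambda>x. 0)"
| "sqrt_iter B (Suc n) = (\<lambda>x. (1/2) *\<^sub>R (B x + sqrt_iter B n (sqrt_iter B n x)))"

text \<open>The iteration for \<open>B = 1\<close>. It increases to \<open>1\<close>, and its increments dominate those of the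
  operator iteration (\<open>Y_step\<close>), which therefore converges.\<close>

primrec scalar_iter :: "nat \<Rightarrow> real" where
  "scalar_iter 0 = 0"
| "scalar_iter (Suc n) = (1 + (scalar_iter n)\<^sup>2) / 2"

lemma scalar_iter_bounds: "0 \<le> scalar_iter n" "scalar_iter n \<le> 1"
proof (induction n)
  case (Suc n)
  show "0 \<le> scalar_iter (Suc n)" by simp
  have "(scalar_iter n)\<^sup>2 \<le> 1" using Suc by (simp add: power_le_one)
  then show "scalar_iter (Suc n) \<le> 1" by simp
qed simp_all

lemma scalar_iter_Suc_ge: "scalar_iter n \<le> scalar_iter (Suc n)"
proof -
  have "0 \<le> (1 - scalar_iter n)\<^sup>2" by simp
  then show ?thesis by (simp add: power2_eq_square algebra_simps)
qed

lemma scalar_iter_convergent: "convergent scalar_iter"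
proof (rule Bseq_mono_convergent)
  show "Bseq scalar_iter"
    using scalar_iter_bounds by (intro BseqI'[of _ 1]) (metis abs_of_nonneg real_norm_def)
  show "\<forall>m. \<forall>n\<ge>m. scalar_iter m \<le> scalar_iter n"
    using lift_Suc_mono_le[of scalar_iter] scalar_iter_Suc_ge by blast
qed

text \<open>The map \<open>L\<close> is only additive and real homogeneous, so that this applies to conjugations too.\<close>

lemma sqrt_iter_intertwine:
  assumes add: "\<And>x y. L (x + y) = L x + L y" and scale: "\<And>r x. L (r *\<^sub>R x) = r *\<^sub>R L x"
    and LB: "\<And>x. L (B x) = B2 (L x)"
  shows "L (sqrt_iter B n x) = sqrt_iter B2 n (L x)"
  using scale[of 0 0] by (induction n arbitrary: x) (simp_all add: add scale LB)

locale selfadjoint_contraction =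
  fixes B :: "'h::chilbert_space \<Rightarrow> 'h"
  assumes B: "bounded_op UNIV UNIV B"
    and B_le: "norm (B x) \<le> norm x"
    and B_sym: "cinner (B x) y = cinner x (B y)"
begin

abbreviation "Y \<equiv> sqrt_iter B"

lemma Y_linear: "Y n (x + y) = Y n x + Y n y" "Y n (c *\<^sub>C x) = c *\<^sub>C Y n x"
  by (induction n arbitrary: x y)
     (simp_all add: bounded_opD[OF B] scaleC_add_right scaleR_add_right scaleR_scaleC scaleC_scaleC
       mult.commute)

lemma Y_diff: "Y n (x - y) = Y n x - Y n y"
  by (metis Y_linear(1) add_diff_cancel_right' diff_add_cancel)

lemma Y_sym: "cinner (Y n x) y = cinner x (Y n y)"
  by (induction n arbitrary: x y) (simp_all add: cinner_simps B_sym)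

lemma Y_bound: "norm (Y n x) \<le> scalar_iter n * norm x"
proof (induction n arbitrary: x)
  case (Suc n)
  have "norm (Y n (Y n x)) \<le> scalar_iter n * norm (Y n x)" by (rule Suc)
  also have "\<dots> \<le> scalar_iter n * (scalar_iter n * norm x)"
    by (intro mult_left_mono Suc scalar_iter_bounds)
  finally have "norm (B x + Y n (Y n x)) \<le> norm x + (scalar_iter n)\<^sup>2 * norm x"
    using norm_triangle_ineq[of "B x" "Y n (Y n x)"] B_le[of x] by (simp add: power2_eq_square)
  then show ?case by (simp only: sqrt_iter.simps norm_scaleR) (simp add: field_simps)
qed simp

text \<open>The identity \<open>P\<^sup>2 - Q\<^sup>2 = P (P - Q) + (P - Q) Q\<close>, for consecutive iterates \<open>P\<close> and \<open>Q\<close>, turns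
  the bound for one increment into the bound for the next.\<close>

lemma Y_step: "norm (Y (Suc n) x - Y n x) \<le> (scalar_iter (Suc n) - scalar_iter n) * norm x"
proof (induction n arbitrary: x)
  case 0
  show ?case using B_le[of x] by simp
next
  case (Suc n)
  define s t where st: "s = scalar_iter n" "t = scalar_iter (Suc n)"
  note st_bounds = scalar_iter_bounds[of n] scalar_iter_bounds[of "Suc n"] scalar_iter_Suc_ge[of n]
  have "Y (Suc (Suc n)) x - Y (Suc n) x
      = (1/2) *\<^sub>R (Y (Suc n) (Y (Suc n) x) - Y n (Y n x))"
    by (simp add: scaleR_diff_right scaleR_add_right)
  also have "\<dots> = (1/2) *\<^sub>R (Y (Suc n) (Y (Suc n) x - Y n x) + (Y (Suc n) (Y n x) - Y n (Y n x)))"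
    by (simp only: Y_diff) simp
  finally have "norm (Y (Suc (Suc n)) x - Y (Suc n) x)
      \<le> (1/2) * (norm (Y (Suc n) (Y (Suc n) x - Y n x)) + norm (Y (Suc n) (Y n x) - Y n (Y n x)))"
    by (simp only: norm_scaleR) (simp add: norm_triangle_ineq del: sqrt_iter.simps)
  moreover have "norm (Y (Suc n) (Y (Suc n) x - Y n x)) \<le> t * ((t - s) * norm x)"
    using Y_bound[of "Suc n" "Y (Suc n) x - Y n x"] Suc[of x] st_bounds unfolding st
    by (meson mult_left_mono order_trans)
  moreover have "norm (Y (Suc n) (Y n x) - Y n (Y n x)) \<le> (t - s) * (s * norm x)"
    using Suc[of "Y n x"] Y_bound[of n x] st_bounds unfolding st
    by (meson diff_ge_0_iff_ge mult_left_mono order_trans)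
  moreover have "(1/2) * (t * ((t - s) * norm x) + (t - s) * (s * norm x))
      = (scalar_iter (Suc (Suc n)) - scalar_iter (Suc n)) * norm x"
    by (simp add: st power2_eq_square field_simps)
  ultimately show ?case by argo
qed

lemma Y_Cauchy: "Cauchy (\<lambda>n. Y n x)"
proof -
  have le: "norm (Y (m + k) x - Y m x) \<le> (scalar_iter (m + k) - scalar_iter m) * norm x" for m k
  proof (induction k)
    case (Suc k)
    have "norm (Y (m + Suc k) x - Y m x)
        \<le> norm (Y (Suc (m + k)) x - Y (m + k) x) + norm (Y (m + k) x - Y m x)"
      using norm_triangle_ineq[of "Y (Suc (m + k)) x - Y (m + k) x" "Y (m + k) x - Y m x"]
      by (simp del: sqrt_iter.simps)
    also have "\<dots> \<le> (scalar_iter (Suc (m + k)) - scalar_iter (m + k)) * norm x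
        + (scalar_iter (m + k) - scalar_iter m) * norm x"
      by (intro add_mono Y_step Suc)
    finally show ?case by (simp add: algebra_simps del: sqrt_iter.simps scalar_iter.simps)
  qed simp
  have "Cauchy (\<lambda>n. scalar_iter n * norm x)"
    using scalar_iter_convergent
    by (intro convergent_Cauchy convergent_mult) (simp_all add: convergent_const)
  then have *: "\<exists>M. \<forall>m\<ge>M. \<forall>n\<ge>M. \<bar>scalar_iter m * norm x - scalar_iter n * norm x\<bar> < e"
    if "e > 0" for e
    using that by (auto simp: Cauchy_def dist_real_def)
  show ?thesis
  proof (rule CauchyI')
    fix e :: real assume "0 < e"
    then obtain M where
      M: "\<And>m n. m \<ge> M \<Longrightarrow> n \<ge> M \<Longrightarrow> \<bar>scalar_iter m * norm x - scalar_iter n * norm x\<bar> < e"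
      using * by blast
    have "dist (Y m x) (Y n x) < e" if "m \<ge> M" "n > m" for m n
    proof -
      have "norm (Y n x - Y m x) \<le> (scalar_iter n - scalar_iter m) * norm x"
        using le[of m "n - m"] that by simp
      then show ?thesis using M[of n m] that
        by (simp add: dist_norm norm_minus_commute algebra_simps)
    qed
    then show "\<exists>M. \<forall>m\<ge>M. \<forall>n>m. dist (Y m x) (Y n x) < e" by blast
  qed
qed

definition Y_lim :: "'h \<Rightarrow> 'h" where "Y_lim x = lim (\<lambda>n. Y n x)"

lemma Y_tendsto: "(\<lambda>n. Y n x) \<longlonglongrightarrow> Y_lim x"
  unfolding Y_lim_def using Y_Cauchy Cauchy_convergent convergent_LIMSEQ_iff by blast

definition root :: "'h \<Rightarrow> 'h" where "root x = x - Y_lim x"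

lemma Y_lim_bound: "norm (Y_lim x) \<le> norm x"
proof (rule LIMSEQ_le_const2[OF tendsto_norm[OF Y_tendsto]])
  have "norm (Y n x) \<le> norm x" for n
    using Y_bound[of n x] scalar_iter_bounds(2)[of n] mult_right_mono[of "scalar_iter n" 1 "norm x"]
    by simp
  then show "\<exists>N. \<forall>n\<ge>N. norm (Y n x) \<le> norm x" by blast
qed

lemma Y_lim_linear: "Y_lim (x + y) = Y_lim x + Y_lim y" "Y_lim (c *\<^sub>C x) = c *\<^sub>C Y_lim x"
proof -
  show "Y_lim (x + y) = Y_lim x + Y_lim y"
    using Y_tendsto[of "x + y"] tendsto_add[OF Y_tendsto[of x] Y_tendsto[of y]]
    by (simp add: Y_linear LIMSEQ_unique)
  show "Y_lim (c *\<^sub>C x) = c *\<^sub>C Y_lim x"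
    using Y_tendsto[of "c *\<^sub>C x"] bounded_linear.tendsto[OF bounded_linear_scaleC Y_tendsto[of x]]
    by (simp add: Y_linear LIMSEQ_unique)
qed

lemma Y_lim_sym: "cinner (Y_lim x) y = cinner x (Y_lim y)"
  using tendsto_cinner[OF Y_tendsto[of x] tendsto_const[of y]]
    tendsto_cinner[OF tendsto_const[of x] Y_tendsto[of y]]
  by (simp add: Y_sym LIMSEQ_unique)

text \<open>The iterates are uniformly bounded, so \<open>Y\<^sub>n (Y\<^sub>n x)\<close> converges to the square of the limit.\<close>

lemma Y_lim_fixpoint: "2 *\<^sub>R Y_lim x = B x + Y_lim (Y_lim x)"
proof -
  have "(\<lambda>n. Y n (Y n x) - Y n (Y_lim x)) \<longlonglongrightarrow> 0"
  proof (rule Lim_null_comparison)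
    have "norm (Y n (Y n x) - Y n (Y_lim x)) \<le> norm (Y n x - Y_lim x)" for n
      using Y_bound[of n "Y n x - Y_lim x"] scalar_iter_bounds(2)[of n]
        mult_right_mono[of "scalar_iter n" 1 "norm (Y n x - Y_lim x)"] by (simp add: Y_diff)
    then show "\<forall>\<^sub>F n in sequentially.
        norm (Y n (Y n x) - Y n (Y_lim x)) \<le> norm (Y n x - Y_lim x)" by simp
    show "(\<lambda>n. norm (Y n x - Y_lim x)) \<longlonglongrightarrow> 0"
      using Y_tendsto[of x] by (intro tendsto_norm_zero) (simp add: LIM_zero)
  qed
  from tendsto_add[OF this Y_tendsto[of "Y_lim x"]]
  have "(\<lambda>n. Y n (Y n x)) \<longlonglongrightarrow> Y_lim (Y_lim x)" by simp
  then have "(\<lambda>n. B x + Y n (Y n x)) \<longlonglongrightarrow> B x + Y_lim (Y_lim x)" by (intro tendsto_intros)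
  moreover have "(\<lambda>n. 2 *\<^sub>R Y (Suc n) x) \<longlonglongrightarrow> 2 *\<^sub>R Y_lim x"
    by (intro tendsto_intros LIMSEQ_Suc[OF Y_tendsto])
  moreover have "2 *\<^sub>R Y (Suc n) x = B x + Y n (Y n x)" for n by simp
  ultimately show ?thesis by (metis (no_types, lifting) LIMSEQ_unique ext)
qed

lemma root_root: "root (root x) = x - B x"
proof -
  have "Y_lim (x - Y_lim x) = Y_lim x - Y_lim (Y_lim x)"
    using Y_lim_linear(1)[of "x - Y_lim x" "Y_lim x"] by (simp add: algebra_simps)
  moreover have "Y_lim (Y_lim x) = 2 *\<^sub>R Y_lim x - B x" by (simp add: Y_lim_fixpoint)
  ultimately show ?thesis by (simp add: root_def scaleR_2)
qed

lemma root_bounded: "bounded_op UNIV UNIV root"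
proof (rule bounded_op_UNIV_I[where K=2])
  show "norm (root x) \<le> 2 * norm x" for x
    using Y_lim_bound[of x] norm_triangle_ineq4[of x "Y_lim x"] by (simp add: root_def)
qed (simp_all add: root_def Y_lim_linear complex_vector.scale_right_diff_distrib)

lemma root_sym: "cinner (root x) y = cinner x (root y)"
  by (simp add: root_def cinner_simps Y_lim_sym)

lemma root_positive: "positive_op root"
  unfolding positive_op_def
proof (intro conjI allI root_bounded)
  fix x
  have "cmod (cinner (Y_lim x) x) \<le> (norm x)\<^sup>2"
    using cmod_cinner_le[of "Y_lim x" x] mult_right_mono[OF Y_lim_bound[of x], of "norm x"]
    by (simp add: power2_eq_square)
  then have "0 \<le> Re (cinner (root x) x)"
    using complex_Re_le_cmod[of "cinner (Y_lim x) x"]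
    by (simp add: root_def cinner_simps cinner_self)
  moreover have "Im (cinner (root x) x) = 0"
    by (metis Reals_cnj_iff cinner_commute complex_is_Real_iff root_sym)
  ultimately show "cinner (root x) x \<in> \<real>\<^sub>\<ge>\<^sub>0" by (simp add: complex_nonneg_Reals_iff)
qed

end

text \<open>Polarisation: the quadratic form is real at \<open>x + y\<close> and at \<open>x + \<i> y\<close>.\<close>

lemma positive_op_sym:
  assumes "positive_op S"
  shows "cinner (S x) y = cinner x (S y)"
proof -
  note S = bounded_opD[OF assms[unfolded positive_op_def, THEN conjunct1]]
  have real: "Im (cinner (S x) x) = 0" for x
    using assms by (auto simp: positive_op_def complex_nonneg_Reals_iff)
  have "Im (cinner (S x) y) + Im (cinner (S y) x) = 0"
    using real[of "x + y"] real[of x] real[of y] by (simp add: S cinner_simps)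
  moreover have "Re (cinner (S x) y) = Re (cinner (S y) x)"
    using real[of "x + \<i> *\<^sub>C y"] real[of x] real[of y] by (simp add: S cinner_simps)
  ultimately have "cinner (S x) y = cnj (cinner (S y) x)" by (simp add: complex_eq_iff)
  then show ?thesis using cinner_commute by metis
qed

text \<open>On the line \<open>y + t S y\<close> the form is a nonnegative quadratic polynomial in \<open>t\<close> without constant
  term, and its linear coefficient is \<open>2 \<parallel>S y\<parallel>\<^sup>2\<close>.\<close>

lemma positive_op_null:
  assumes pos: "positive_op S" and null: "cinner (S y) y = 0"
  shows "S y = 0"
proof -
  note S = bounded_opD[OF pos[unfolded positive_op_def, THEN conjunct1]]
  define a b where "a = (norm (S y))\<^sup>2" and "b = Re (cinner (S (S y)) (S y))"
  have nonneg: "0 \<le> Re (cinner (S x) x)" for x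
    using pos by (auto simp: positive_op_def complex_nonneg_Reals_iff)
  have "cinner (S (S y)) y = cinner (S y) (S y)" by (rule positive_op_sym[OF pos])
  then have *: "0 \<le> 2 * t * a + t\<^sup>2 * b" for t :: real
    using nonneg[of "y + complex_of_real t *\<^sub>C S y"] null
    by (simp add: S cinner_simps a_def b_def cinner_self power2_eq_square algebra_simps)
  have b: "0 \<le> b" using nonneg by (simp add: b_def)
  have "a = 0" using * b by (rule linear_term_eq_0)
  then show ?thesis by (simp add: a_def)
qed

context selfadjoint_contraction
begin

text \<open>If \<open>L\<close> carries \<open>B\<close> to \<open>B2\<close>, it carries every iterate for \<open>B\<close> to the one for \<open>B2\<close>, and by
  continuity also their limits.\<close>

lemma root_intertwine:
  assumes L: "bounded_linear L" and B2: "selfadjoint_contraction B2" and LB: "\<And>x. L (B x) = B2 (L x)"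
  shows "L (root x) = selfadjoint_contraction.root B2 (L x)"
proof -
  interpret L: bounded_linear L by (rule L)
  interpret B2: selfadjoint_contraction B2 by (rule B2)
  have "(\<lambda>n. L (Y n x)) \<longlonglongrightarrow> L (Y_lim x)" by (intro L.tendsto Y_tendsto)
  moreover have "L (Y n x) = sqrt_iter B2 n (L x)" for n
    by (rule sqrt_iter_intertwine) (simp_all add: L.add L.scaleR LB)
  ultimately have "(\<lambda>n. sqrt_iter B2 n (L x)) \<longlonglongrightarrow> L (Y_lim x)" by simp
  then have "L (Y_lim x) = B2.Y_lim (L x)" using B2.Y_tendsto by (rule LIMSEQ_unique)
  then show ?thesis by (simp add: root_def B2.root_def L.diff)
qed

text \<open>Any positive square root \<open>S\<close> of \<open>I - B\<close> commutes with its square, hence with \<open>B\<close> and with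
  \<open>root\<close>; therefore \<open>(S + root) (S - root) = 0\<close>, and positivity forces \<open>S = root\<close>.\<close>

lemma op_sqrt_eq: "op_sqrt (\<lambda>x. x - B x) = root"
  unfolding op_sqrt_def
proof (rule the_equality)
  show "positive_op root \<and> root \<circ> root = (\<lambda>x. x - B x)"
    by (simp add: root_positive root_root fun_eq_iff)
  fix S assume S: "positive_op S \<and> S \<circ> S = (\<lambda>x. x - B x)"
  then have SS: "S (S x) = x - B x" for x by (metis comp_apply)
  have Sb: "bounded_linear S"
    using S bounded_op_UNIV_linear unfolding positive_op_def by blast
  interpret S: bounded_linear S by (rule Sb)
  interpret R: bounded_linear root by (rule bounded_op_UNIV_linear[OF root_bounded])
  have "S (B x) = B (S x)" for x
    using SS[of "S x"] arg_cong[OF SS[of x], of S] by (simp add: S.diff)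
  then have comm: "S (root x) = root (S x)" for x
    by (intro root_intertwine Sb selfadjoint_contraction_axioms)
  show "S = root"
  proof
    fix x
    \<comment> \<open>\<open>S + root\<close> vanishes on the range of \<open>S - root\<close>, and both summands are positive\<close>
    define y where "y = S x - root x"
    have "S y + root y = 0"
      by (simp add: y_def S.diff R.diff SS root_root comm)
    then have "cinner (S y) y + cinner (root y) y = 0"
      by (metis cinner_add_left cinner_zero_left)
    moreover have "cinner (S y) y \<in> \<real>\<^sub>\<ge>\<^sub>0" "cinner (root y) y \<in> \<real>\<^sub>\<ge>\<^sub>0"
      using S root_positive unfolding positive_op_def by blast+
    ultimately have "cinner (S y) y = 0" "cinner (root y) y = 0"
      by (auto simp: complex_nonneg_Reals_iff complex_eq_iff)
    then have "S y = 0" "root y = 0"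
      using S root_positive positive_op_null by blast+
    then have "cinner y y = 0"
      using positive_op_sym[of S x y] root_sym[of x y] S by (simp add: y_def cinner_diff_left)
    then show "S x = root x" by (simp add: y_def)
  qed
qed

end

section \<open>Conjugations determined on generators\<close>

text \<open>An assignment \<open>a \<mapsto> b\<close> on generators is kept as a set \<open>P\<close> of pairs, so that no linear
  independence is involved. A pair \<open>(x, y)\<close> is scaled to \<open>(c x, cnj c y)\<close>; the span in this sense is
  the graph of the antilinear extension, and its closure that of the continuous one.\<close>

inductive_set conj_span :: "('a::chilbert_space \<times> 'a) set \<Rightarrow> ('a \<times> 'a) set" for P where
  zero: "(0, 0) \<in> conj_span P"
| step: "(a, b) \<in> P \<Longrightarrow> (x, y) \<in> conj_span P \<Longrightarrow> (c *\<^sub>C a + x, cnj c *\<^sub>C b + y) \<in> conj_span P"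

lemma conj_span_base: "(a, b) \<in> P \<Longrightarrow> (a, b) \<in> conj_span P"
  using conj_span.step[OF _ conj_span.zero, of a b P 1] by (simp add: scaleC_one)

lemma conj_span_add:
  "(x, y) \<in> conj_span P \<Longrightarrow> (x', y') \<in> conj_span P \<Longrightarrow> (x + x', y + y') \<in> conj_span P"
  by (induction rule: conj_span.induct) (auto simp: add.assoc intro: conj_span.step)

lemma conj_span_scale: "(x, y) \<in> conj_span P \<Longrightarrow> (c *\<^sub>C x, cnj c *\<^sub>C y) \<in> conj_span P"
proof (induction rule: conj_span.induct)
  case (step a b x y d)
  then show ?case
    using conj_span.step[OF step(1,3), of "c * d"] by (simp add: scaleC_add_right scaleC_scaleC)
qed (simp add: conj_span.zero)

lemma conj_span_swap:
  assumes "\<And>a b. (a, b) \<in> P \<Longrightarrow> (b, a) \<in> P"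
  shows "(x, y) \<in> conj_span P \<Longrightarrow> (y, x) \<in> conj_span P"
proof (induction rule: conj_span.induct)
  case (step a b x y c)
  then show ?case
    using conj_span.step[OF assms[OF step(1)] step(3), of "cnj c"] by simp
qed (simp add: conj_span.zero)

lemma conj_span_gram:
  assumes gram: "\<And>a b c d. (a, b) \<in> P \<Longrightarrow> (c, d) \<in> P \<Longrightarrow> cinner b d = cinner c a"
  shows "(x, y) \<in> conj_span P \<Longrightarrow> (x', y') \<in> conj_span P \<Longrightarrow> cinner y y' = cinner x' x"
proof (induction rule: conj_span.induct)
  case (step a b x y c)
  have "(u, v) \<in> conj_span P \<Longrightarrow> cinner b v = cinner u a" for u v
    by (induction rule: conj_span.induct) (simp_all add: cinner_simps gram[OF step(1)])
  then show ?case using step by (simp add: cinner_simps)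
qed simp

abbreviation conj_closure :: "('a::chilbert_space \<times> 'a) set \<Rightarrow> ('a \<times> 'a) set" where
  "conj_closure P \<equiv> closure (conj_span P)"

lemma conj_closure_seq:
  assumes "(x, y) \<in> conj_closure P"
  shows "\<exists>f g. (\<forall>n. (f n, g n) \<in> conj_span P) \<and> f \<longlonglongrightarrow> x \<and> g \<longlonglongrightarrow> y"
proof -
  obtain h where h: "\<And>n. h n \<in> conj_span P" "h \<longlonglongrightarrow> (x, y)"
    using assms by (meson closure_sequential)
  have "(\<lambda>n. fst (h n)) \<longlonglongrightarrow> x" "(\<lambda>n. snd (h n)) \<longlonglongrightarrow> y"
    using tendsto_fst[OF h(2)] tendsto_snd[OF h(2)] by simp_all
  then show ?thesis
    using h(1) by (intro exI[of _ "\<lambda>n. fst (h n)"] exI[of _ "\<lambda>n. snd (h n)"]) simp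
qed

lemma conj_closure_seqI:
  assumes "\<And>n. (f n, g n) \<in> conj_closure P" "f \<longlonglongrightarrow> x" "g \<longlonglongrightarrow> y"
  shows "(x, y) \<in> conj_closure P"
  using closed_sequentially[OF closed_closure, of "\<lambda>n. (f n, g n)" "conj_span P" "(x, y)"]
    tendsto_Pair[OF assms(2,3)] assms(1) by blast

lemma conj_spanD: "p \<in> conj_span P \<Longrightarrow> p \<in> conj_closure P"
  using closure_subset by blast

lemma conj_closure_add:
  assumes "(x, y) \<in> conj_closure P" "(x', y') \<in> conj_closure P"
  shows "(x + x', y + y') \<in> conj_closure P"
proof -
  obtain f g where 1: "\<forall>n. (f n, g n) \<in> conj_span P" "f \<longlonglongrightarrow> x" "g \<longlonglongrightarrow> y"
    using conj_closure_seq[OF assms(1)] by blast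
  obtain f' g' where 2: "\<forall>n. (f' n, g' n) \<in> conj_span P" "f' \<longlonglongrightarrow> x'" "g' \<longlonglongrightarrow> y'"
    using conj_closure_seq[OF assms(2)] by blast
  show ?thesis
    by (rule conj_closure_seqI[where f="\<lambda>n. f n + f' n" and g="\<lambda>n. g n + g' n"])
      (use 1 2 in \<open>auto intro!: conj_spanD conj_span_add tendsto_add\<close>)
qed

lemma conj_closure_scale:
  assumes "(x, y) \<in> conj_closure P"
  shows "(c *\<^sub>C x, cnj c *\<^sub>C y) \<in> conj_closure P"
proof -
  obtain f g where 1: "\<forall>n. (f n, g n) \<in> conj_span P" "f \<longlonglongrightarrow> x" "g \<longlonglongrightarrow> y"
    using conj_closure_seq[OF assms(1)] by blast
  show ?thesis
    by (rule conj_closure_seqI[where f="\<lambda>n. c *\<^sub>C f n" and g="\<lambda>n. cnj c *\<^sub>C g n"])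
      (use 1 in \<open>auto intro!: conj_spanD conj_span_scale
          bounded_linear.tendsto[OF bounded_linear_scaleC]\<close>)
qed

lemma conj_closure_swap:
  assumes "\<And>a b. (a, b) \<in> P \<Longrightarrow> (b, a) \<in> P" and xy: "(x, y) \<in> conj_closure P"
  shows "(y, x) \<in> conj_closure P"
proof -
  obtain f g where 1: "\<forall>n. (f n, g n) \<in> conj_span P" "f \<longlonglongrightarrow> x" "g \<longlonglongrightarrow> y"
    using conj_closure_seq[OF xy] by blast
  have "(g n, f n) \<in> conj_closure P" for n
    by (rule conj_spanD, rule conj_span_swap) (use assms(1) 1(1) in auto)
  then show ?thesis by (rule conj_closure_seqI[OF _ 1(3,2)])
qed

lemma conj_closure_gram:
  assumes gram: "\<And>a b c d. (a, b) \<in> P \<Longrightarrow> (c, d) \<in> P \<Longrightarrow> cinner b d = cinner c a"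
    and "(x, y) \<in> conj_closure P" "(x', y') \<in> conj_closure P"
  shows "cinner y y' = cinner x' x"
proof -
  obtain f g where 1: "\<forall>n. (f n, g n) \<in> conj_span P" "f \<longlonglongrightarrow> x" "g \<longlonglongrightarrow> y"
    using conj_closure_seq[OF assms(2)] by blast
  obtain f' g' where 2: "\<forall>n. (f' n, g' n) \<in> conj_span P" "f' \<longlonglongrightarrow> x'" "g' \<longlonglongrightarrow> y'"
    using conj_closure_seq[OF assms(3)] by blast
  have "cinner (g n) (g' n) = cinner (f' n) (f n)" for n
    using conj_span_gram[OF gram] 1(1) 2(1) by blast
  moreover have "(\<lambda>n. cinner (g n) (g' n)) \<longlonglongrightarrow> cinner y y'" "(\<lambda>n. cinner (f' n) (f n)) \<longlonglongrightarrow> cinner x' x"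
    by (intro tendsto_intros 1 2)+
  ultimately show ?thesis using LIMSEQ_unique by simp
qed

text \<open>The relation \<open>C F = G C\<close> for the map \<open>C\<close> with graph \<open>conj_closure P\<close> follows from the generators.\<close>

lemma conj_closure_map:
  assumes F: "bounded_op UNIV UNIV F" and G: "bounded_op UNIV UNIV G"
    and gen: "\<And>a b. (a, b) \<in> P \<Longrightarrow> (F a, G b) \<in> conj_closure P"
    and xy: "(x, y) \<in> conj_closure P"
  shows "(F x, G y) \<in> conj_closure P"
proof -
  interpret F: bounded_linear F by (rule bounded_op_UNIV_linear[OF F])
  interpret G: bounded_linear G by (rule bounded_op_UNIV_linear[OF G])
  have span: "(F x, G y) \<in> conj_closure P" if "(x, y) \<in> conj_span P" for x y
    using that
  proof (induction rule: conj_span.induct)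
    case zero
    then show ?case by (simp add: F.zero G.zero conj_spanD conj_span.zero)
  next
    case (step a b x y c)
    then show ?case
      using conj_closure_add[OF conj_closure_scale[OF gen[OF step(1)], of c] step(3)]
      by (simp add: bounded_opD[OF F] bounded_opD[OF G])
  qed
  obtain f g where 1: "\<forall>n. (f n, g n) \<in> conj_span P" "f \<longlonglongrightarrow> x" "g \<longlonglongrightarrow> y"
    using conj_closure_seq[OF xy] by blast
  show ?thesis
    by (rule conj_closure_seqI[where f="\<lambda>n. F (f n)" and g="\<lambda>n. G (g n)"])
      (use 1 in \<open>auto intro!: span F.tendsto G.tendsto\<close>)
qed

text \<open>The Gram condition passes to the closed graph, which is therefore the graph of an isometry with
  closed domain. The domain is all of \<open>E\<close> because the generators are total, and the symmetry of
  \<open>P\<close> makes the map an involution.\<close>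

lemma conjugation_from_pairs:
  fixes E :: "'a::chilbert_space set"
  assumes E: "closed_csubspace E" and PE: "\<And>a b. (a, b) \<in> P \<Longrightarrow> a \<in> E"
    and sym: "\<And>a b. (a, b) \<in> P \<Longrightarrow> (b, a) \<in> P"
    and gram: "\<And>a b c d. (a, b) \<in> P \<Longrightarrow> (c, d) \<in> P \<Longrightarrow> cinner b d = cinner c a"
    and total: "\<And>h. h \<in> E \<Longrightarrow> (\<And>a b. (a, b) \<in> P \<Longrightarrow> cinner a h = 0) \<Longrightarrow> h = 0"
  obtains C where "conjugation_on E C" "\<And>x. x \<in> E \<Longrightarrow> (x, C x) \<in> conj_closure P"
    "\<And>x y. (x, y) \<in> conj_closure P \<Longrightarrow> y = C x"
proof -
  have cg: "cinner y y' = cinner x' x"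
    if "(x, y) \<in> conj_closure P" "(x', y') \<in> conj_closure P" for x y x' y'
    by (rule conj_closure_gram[OF _ that]) (rule gram)
  have sw: "(y, x) \<in> conj_closure P" if "(x, y) \<in> conj_closure P" for x y
    by (rule conj_closure_swap[OF _ that]) (rule sym)
  have norm_eq: "norm (y - y') = norm (x - x')"
    if "(x, y) \<in> conj_closure P" "(x', y') \<in> conj_closure P" for x y x' y'
  proof -
    have "(x - x', y - y') \<in> conj_closure P"
      using conj_closure_add[OF that(1) conj_closure_scale[OF that(2), of "-1"]]
      by (simp flip: scaleC_minus1)
    then have "cinner (y - y') (y - y') = cinner (x - x') (x - x')" using cg by blast
    then have "complex_of_real ((norm (y - y'))\<^sup>2) = of_real ((norm (x - x'))\<^sup>2)"
      by (simp only: cinner_self)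
    then show ?thesis by (simp only: of_real_eq_iff) (simp add: power2_eq_iff_nonneg)
  qed
  define M where "M = fst ` conj_closure P"
  have span_E: "(x, y) \<in> conj_span P \<Longrightarrow> x \<in> E" for x y
    by (induction rule: conj_span.induct) (auto simp: closed_csubspaceD[OF E] PE)
  have ME: "M \<subseteq> E"
  proof
    fix x assume "x \<in> M"
    then obtain y where "(x, y) \<in> conj_closure P" unfolding M_def by auto
    then obtain f g where "\<forall>n. (f n, g n) \<in> conj_span P" "f \<longlonglongrightarrow> x"
      using conj_closure_seq by blast
    then show "x \<in> E" using closed_sequentially[OF closed_csubspaceD(1)[OF E]] span_E by blast
  qed
  have closed: "closed M"
    unfolding closed_sequential_limits
  proof safe
    fix f x assume f: "\<forall>n. f n \<in> M" "f \<longlonglongrightarrow> x"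
    then have "\<forall>n. \<exists>y. (f n, y) \<in> conj_closure P" unfolding M_def by force
    then obtain g where g: "\<And>n. (f n, g n) \<in> conj_closure P" by metis
    have "Cauchy g"
      using LIMSEQ_imp_Cauchy[OF f(2)] norm_eq[OF g g] by (simp add: Cauchy_def dist_norm)
    then obtain y where "g \<longlonglongrightarrow> y" using Cauchy_convergent_iff convergent_def by blast
    then show "x \<in> M" using conj_closure_seqI[OF g f(2)] unfolding M_def by force
  qed
  have Msub: "closed_csubspace M"
    unfolding closed_csubspace_def complex_vector.subspace_def
  proof (intro conjI ballI allI closed)
    show "0 \<in> M" unfolding M_def using conj_spanD[OF conj_span.zero] by force
    show "x + y \<in> M" if "x \<in> M" "y \<in> M" for x y
      using that conj_closure_add unfolding M_def by force
    show "c *\<^sub>C x \<in> M" if "x \<in> M" for c x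
      using that conj_closure_scale unfolding M_def by force
  qed
  have "h \<in> M" if "h \<in> E" for h
  proof -
    obtain a where a: "a \<in> M" "\<And>u. u \<in> M \<Longrightarrow> cinner u (h - a) = 0"
      using orthogonal_projection[OF Msub] by blast
    have "h - a = 0"
    proof (rule total)
      show "h - a \<in> E" using that a(1) ME closed_csubspaceD(5)[OF E] by blast
      show "cinner u (h - a) = 0" if "(u, v) \<in> P" for u v
        using a(2) conj_spanD[OF conj_span_base[OF that]] unfolding M_def by force
    qed
    with a show ?thesis by simp
  qed
  then have "\<forall>x\<in>E. \<exists>y. (x, y) \<in> conj_closure P" unfolding M_def by force
  then obtain C where C: "\<And>x. x \<in> E \<Longrightarrow> (x, C x) \<in> conj_closure P" by metis
  have uniq: "y = C x" if "(x, y) \<in> conj_closure P" for x y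
  proof -
    have "x \<in> E" using that ME unfolding M_def by force
    then show ?thesis using norm_eq[OF that C[of x]] by simp
  qed
  have "conjugation_on E C"
    unfolding conjugation_on_def antilinear_on_def
  proof (intro conjI ballI allI)
    show "C ` E \<subseteq> E"
      using sw[OF C] ME unfolding M_def by force
    show "C (x + y) = C x + C y" if "x \<in> E" "y \<in> E" for x y
      using uniq[OF conj_closure_add[OF C C]] that by simp
    show "C (c *\<^sub>C x) = cnj c *\<^sub>C C x" if "x \<in> E" for c x
      using uniq[OF conj_closure_scale[OF C]] that by simp
    show "C (C x) = x" if "x \<in> E" for x
      using uniq[OF sw[OF C]] that by simp
    show "cinner (C x) (C y) = cinner y x" if "x \<in> E" "y \<in> E" for x y
      using cg[OF C C] that by blast
  qed
  then show ?thesis using that C uniq by blast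
qed

lemma maximal_pairwise_subset:
  obtains S where "S \<subseteq> X" "\<And>x y. x \<in> S \<Longrightarrow> y \<in> S \<Longrightarrow> x \<noteq> y \<Longrightarrow> R x y"
    "\<And>h. h \<in> X \<Longrightarrow> (\<And>s. s \<in> S \<Longrightarrow> R h s \<and> R s h) \<Longrightarrow> h \<in> S"
proof -
  define \<A> where "\<A> = {S. S \<subseteq> X \<and> pairwise R S}"
  have "\<exists>M\<in>\<A>. \<forall>Z\<in>\<A>. M \<subseteq> Z \<longrightarrow> Z = M"
  proof (rule subset_Zorn_nonempty)
    show "\<A> \<noteq> {}" unfolding \<A>_def by auto
    show "\<Union>\<C> \<in> \<A>" if "\<C> \<noteq> {}" "subset.chain \<A> \<C>" for \<C>
    proof -
      have "R x y" if xy: "x \<in> U" "U \<in> \<C>" "y \<in> V" "V \<in> \<C>" "x \<noteq> y" for x y U V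
      proof -
        have "U \<subseteq> V \<or> V \<subseteq> U" "U \<in> \<A>" "V \<in> \<A>"
          using \<open>subset.chain \<A> \<C>\<close> xy unfolding subset.chain_def by blast+
        then show ?thesis using xy unfolding \<A>_def pairwise_def by blast
      qed
      moreover have "\<Union>\<C> \<subseteq> X" using that unfolding subset.chain_def \<A>_def by blast
      ultimately show ?thesis unfolding \<A>_def pairwise_def by blast
    qed
  qed
  then obtain S where S: "S \<in> \<A>" "\<And>Z. Z \<in> \<A> \<Longrightarrow> S \<subseteq> Z \<Longrightarrow> Z = S" by blast
  show ?thesis
  proof (rule that)
    show "S \<subseteq> X" using S(1) unfolding \<A>_def by blast
    show "R x y" if "x \<in> S" "y \<in> S" "x \<noteq> y" for x y
      using S(1) that unfolding \<A>_def pairwise_def by blast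
    show "h \<in> S" if "h \<in> X" "\<And>s. s \<in> S \<Longrightarrow> R h s \<and> R s h" for h
    proof -
      have "insert h S \<in> \<A>"
        using S(1) that unfolding \<A>_def by (auto simp: pairwise_insert)
      then show ?thesis using S(2) by blast
    qed
  qed
qed

text \<open>The conjugation that fixes every vector of a maximal orthogonal set.\<close>

lemma conjugation_on_exists:
  assumes E: "closed_csubspace (E :: 'a::chilbert_space set)"
  obtains C where "conjugation_on E C"
proof -
  obtain S where S: "S \<subseteq> E" "\<And>x y. x \<in> S \<Longrightarrow> y \<in> S \<Longrightarrow> x \<noteq> y \<Longrightarrow> cinner x y = 0"
    "\<And>h. h \<in> E \<Longrightarrow> (\<And>s. s \<in> S \<Longrightarrow> cinner h s = 0 \<and> cinner s h = 0) \<Longrightarrow> h \<in> S"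
    using maximal_pairwise_subset[of E "\<lambda>x y. cinner x y = 0"] by blast
  have gram: "cinner s t = cinner t s" if "s \<in> S" "t \<in> S" for s t
    using S(2)[of s t] S(2)[of t s] that by (cases "s = t") auto
  have total: "h = 0" if "h \<in> E" and 0: "\<And>s. s \<in> S \<Longrightarrow> cinner s h = 0" for h
  proof -
    have "cinner h s = 0" if "s \<in> S" for s using 0[OF that] cinner_commute[of h s] by simp
    then have "h \<in> S" using S(3) that(1) 0 by blast
    then show ?thesis using 0[of h] by simp
  qed
  show ?thesis
  proof (rule conjugation_from_pairs[OF E, of "(\<lambda>s. (s, s)) ` S"])
    show "thesis" if "conjugation_on E C" for C by (rule \<open>\<And>C. conjugation_on E C \<Longrightarrow> thesis\<close>[OF that])
    show "h = 0" if "h \<in> E" "\<And>a b. (a, b) \<in> (\<lambda>s. (s, s)) ` S \<Longrightarrow> cinner a h = 0" for h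
      using total[OF that(1)] that(2) by blast
  qed (use S(1) gram in auto)
qed


section \<open>Unitary and antiunitary maps between closed subspaces\<close>

definition antiunitary_on ::
  "'a::chilbert_space set \<Rightarrow> 'b::chilbert_space set \<Rightarrow> ('a \<Rightarrow> 'b) \<Rightarrow> bool" where
  "antiunitary_on E F J \<longleftrightarrow>
     antilinear_on E J \<and> J ` E = F \<and> (\<forall>x\<in>E. \<forall>y\<in>E. cinner (J x) (J y) = cinner y x)"

lemma antiunitary_onD:
  assumes "antiunitary_on E F J"
  shows "x \<in> E \<Longrightarrow> y \<in> E \<Longrightarrow> J (x + y) = J x + J y" "x \<in> E \<Longrightarrow> J (c *\<^sub>C x) = cnj c *\<^sub>C J x"
    "x \<in> E \<Longrightarrow> J x \<in> F" "x \<in> E \<Longrightarrow> y \<in> E \<Longrightarrow> cinner (J x) (J y) = cinner y x"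
    "w \<in> F \<Longrightarrow> \<exists>x\<in>E. J x = w"
  using assms unfolding antiunitary_on_def antilinear_on_def by auto

lemma antiunitary_on_norm:
  assumes "antiunitary_on E F J" "x \<in> E"
  shows "norm (J x) = norm x"
proof -
  have "complex_of_real ((norm (J x))\<^sup>2) = of_real ((norm x)\<^sup>2)"
    unfolding cinner_self[symmetric] by (rule antiunitary_onD(4)[OF assms(1,2,2)])
  then show ?thesis by (simp only: of_real_eq_iff) (simp add: power2_eq_iff_nonneg)
qed

text \<open>Polarisation, with the imaginary part taken from the pair \<open>x\<close>, \<open>\<i> y\<close>.\<close>

lemma isometric_antilinear_imp_antiunitary:
  assumes E: "closed_csubspace E" and J: "antilinear_on E J"
    and iso: "\<And>x. x \<in> E \<Longrightarrow> norm (J x) = norm x" and onto: "J ` E = F"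
  shows "antiunitary_on E F J"
proof -
  have add: "J (x + y) = J x + J y" and scale: "J (c *\<^sub>C x) = cnj c *\<^sub>C J x"
    if "x \<in> E" "y \<in> E" for x y c
    using J that unfolding antilinear_on_def by blast+
  have re: "Re (cinner (J x) (J y)) = Re (cinner x y)" if "x \<in> E" "y \<in> E" for x y
  proof -
    have "norm (J x + J y) = norm (x + y)"
      using iso[of "x + y"] add[OF that] closed_csubspaceD(3)[OF E that] by simp
    then show ?thesis
      using norm_add_sq[of "J x" "J y"] norm_add_sq[of x y] iso[OF that(1)] iso[OF that(2)] by simp
  qed
  have "cinner (J x) (J y) = cinner y x" if "x \<in> E" "y \<in> E" for x y
  proof -
    have "Im (cinner (J x) (J y)) = - Im (cinner x y)"
      using re[OF that(1) closed_csubspaceD(4)[OF E that(2), of \<i>]] scale[OF that(2,2), of \<i>]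
      by (simp add: cinner_simps)
    then have "cinner (J x) (J y) = cnj (cinner x y)"
      using re[OF that] by (simp add: complex_eq_iff)
    then show ?thesis using cinner_commute[of y x] by simp
  qed
  then show ?thesis using J onto unfolding antiunitary_on_def by blast
qed

lemma conjugation_imp_antiunitary:
  assumes "conjugation_on E C"
  shows "antiunitary_on E E C"
proof -
  have "x \<in> C ` E" if "x \<in> E" for x
    using assms that unfolding conjugation_on_def by (intro image_eqI[of _ _ "C x"]) auto
  then show ?thesis using assms unfolding conjugation_on_def antiunitary_on_def by blast
qed

text \<open>The equation \<open>A = J A\<^sup>* J\<close> says that the bilinear form \<open>\<langle>A u, J x\<rangle>\<close> is symmetric; in this
  form it can be compared coefficient by coefficient and moved along unitary maps.\<close>

lemma adj_symmetric_iff: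
  assumes E: "closed_csubspace E" and A: "bounded_op E F A" and J: "antiunitary_on E F J"
  shows "(\<forall>x\<in>E. A x = J (adj_on E A (J x))) \<longleftrightarrow>
    (\<forall>u\<in>E. \<forall>x\<in>E. cinner (A u) (J x) = cinner (A x) (J u))"
proof (intro iffI ballI)
  fix u x assume eq: "\<forall>x\<in>E. A x = J (adj_on E A (J x))" and u: "u \<in> E" and x: "x \<in> E"
  have "cinner (A u) (J x) = cinner u (adj_on E A (J x))" by (rule cinner_adj_on[OF E A u])
  also have "\<dots> = cinner (J (adj_on E A (J x))) (J u)"
    using antiunitary_onD(4)[OF J adj_on_in[OF E A] u] by simp
  finally show "cinner (A u) (J x) = cinner (A x) (J u)" using eq x by simp
next
  fix x assume sym: "\<forall>u\<in>E. \<forall>x\<in>E. cinner (A u) (J x) = cinner (A x) (J u)" and x: "x \<in> E"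
  obtain a where a: "a \<in> E" "J a = A x"
    using antiunitary_onD(5)[OF J bounded_opD(1)[OF A x]] by blast
  have "adj_on E A (J x) = a"
  proof (rule adj_on_eq[OF E a(1)])
    fix u assume "u \<in> E"
    then show "cinner (A u) (J x) = cinner u a"
      using sym x antiunitary_onD(4)[OF J a(1)] a(2) by simp
  qed
  then show "A x = J (adj_on E A (J x))" using a by simp
qed

lemma unitary_onD:
  assumes "unitary_on E F U"
  shows "x \<in> E \<Longrightarrow> y \<in> E \<Longrightarrow> U (x + y) = U x + U y" "x \<in> E \<Longrightarrow> U (c *\<^sub>C x) = c *\<^sub>C U x"
    "x \<in> E \<Longrightarrow> U x \<in> F" "x \<in> E \<Longrightarrow> y \<in> E \<Longrightarrow> cinner (U x) (U y) = cinner x y"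
    "w \<in> F \<Longrightarrow> \<exists>x\<in>E. U x = w"
  using assms unfolding unitary_on_def clinear_on_def by auto

lemma unitary_on_norm:
  assumes "unitary_on E F U" "x \<in> E"
  shows "norm (U x) = norm x"
proof -
  have "complex_of_real ((norm (U x))\<^sup>2) = of_real ((norm x)\<^sup>2)"
    unfolding cinner_self[symmetric] by (rule unitary_onD(4)[OF assms(1,2,2)])
  then show ?thesis by (simp only: of_real_eq_iff) (simp add: power2_eq_iff_nonneg)
qed

lemma antiunitary_unitary_comp:
  assumes "unitary_on E F U" "antiunitary_on F G J"
  shows "antiunitary_on E G (\<lambda>x. J (U x))"
  using assms unitary_onD[OF assms(1)]
  unfolding antiunitary_on_def antilinear_on_def unitary_on_def by (simp flip: image_image)

lemma unitary_antiunitary_comp: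
  assumes "antiunitary_on E F J" "unitary_on F G U"
  shows "antiunitary_on E G (\<lambda>x. U (J x))"
  using assms antiunitary_onD[OF assms(1)]
  unfolding antiunitary_on_def clinear_on_def antilinear_on_def unitary_on_def
  by (simp flip: image_image)

lemma antiunitary_antiunitary_comp:
  assumes "antiunitary_on E F J" "antiunitary_on F G K"
  shows "unitary_on E G (\<lambda>x. K (J x))"
  using assms antiunitary_onD[OF assms(1)]
  unfolding antiunitary_on_def clinear_on_def antilinear_on_def unitary_on_def
  by (simp flip: image_image)

lemma antiunitary_on_inv:
  assumes E: "closed_csubspace E" and F: "closed_csubspace F" and J: "antiunitary_on E F J"
  shows "antiunitary_on F E (inv_into E J)"
proof -
  define K where "K = inv_into E J"
  note J' = antiunitary_onD[OF J]
  have JK: "J (K y) = y" and K_in: "K y \<in> E" if "y \<in> F" for y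
    using J that unfolding antiunitary_on_def K_def by (auto intro: f_inv_into_f inv_into_into)
  have inj: "x = y" if "x \<in> E" "y \<in> E" "J x = J y" for x y
  proof -
    have xy: "x - y \<in> E" by (rule closed_csubspaceD(5)[OF E that(1,2)])
    have "cinner (x - y) x = cinner (x - y) y"
      using J'(4)[OF that(1) xy] J'(4)[OF that(2) xy] that(3) by simp
    then show ?thesis using cinner_self_eq_0[of "x - y"] by (simp add: cinner_diff_right)
  qed
  show ?thesis
    unfolding K_def[symmetric] antiunitary_on_def antilinear_on_def
  proof (intro conjI ballI allI)
    show "K (x + y) = K x + K y" if "x \<in> F" "y \<in> F" for x y
    proof (rule inj)
      show "J (K (x + y)) = J (K x + K y)"
        using that closed_csubspaceD(3)[OF F that] by (simp add: J'(1) JK K_in)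
    qed (use that closed_csubspaceD(3)[OF F that] closed_csubspaceD(3)[OF E] K_in in auto)
    show "K (c *\<^sub>C x) = cnj c *\<^sub>C K x" if "x \<in> F" for c x
    proof (rule inj)
      show "J (K (c *\<^sub>C x)) = J (cnj c *\<^sub>C K x)"
        using that closed_csubspaceD(4)[OF F that] by (simp add: J'(2) JK K_in)
    qed (use that closed_csubspaceD(4)[OF F that] closed_csubspaceD(4)[OF E] K_in in auto)
    show "K ` F = E"
    proof
      show "K ` F \<subseteq> E" using K_in by blast
      show "E \<subseteq> K ` F"
      proof
        fix x assume x: "x \<in> E"
        have "x = K (J x)" by (rule inj) (simp_all add: x K_in JK J'(3))
        then show "x \<in> K ` F" using J'(3)[OF x] by blast
      qed
    qed
    show "cinner (K x) (K y) = cinner y x" if "x \<in> F" "y \<in> F" for x y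
      using J'(4)[OF K_in K_in, OF that(2,1)] by (simp add: JK that)
  qed
qed

lemma adj_on_unitary:
  assumes E: "closed_csubspace E" and U: "unitary_on E F U" and x: "x \<in> E"
  shows "adj_on E U (U x) = x"
  by (rule adj_on_eq[OF E x]) (simp add: unitary_onD(4)[OF U] x)

lemma unitary_on_adj:
  assumes E: "closed_csubspace E" and U: "unitary_on E F U"
  shows "unitary_on F E (adj_on E U)"
proof -
  note U' = unitary_onD[OF U]
  note inv = adj_on_unitary[OF E U]
  have F: "F = U ` E" using U by (simp add: unitary_on_def)
  show ?thesis
    unfolding unitary_on_def clinear_on_def
  proof (intro conjI ballI allI)
    fix v w c assume "v \<in> F" "w \<in> F"
    then obtain x y where x: "x \<in> E" "v = U x" and y: "y \<in> E" "w = U y" unfolding F by blast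
    show "adj_on E U (v + w) = adj_on E U v + adj_on E U w"
      using inv[OF closed_csubspaceD(3)[OF E x(1) y(1)]] x y by (simp add: U'(1) inv)
    show "cinner (adj_on E U v) (adj_on E U w) = cinner v w"
      using x y by (simp add: inv U'(4))
  next
    fix c v assume "v \<in> F"
    then obtain x where x: "x \<in> E" "v = U x" unfolding F by blast
    show "adj_on E U (c *\<^sub>C v) = c *\<^sub>C adj_on E U v"
      using inv[OF closed_csubspaceD(4)[OF E x(1), of c]] x by (simp add: U'(2) inv)
  next
    show "adj_on E U ` F = E" unfolding F image_image by (simp add: inv)
  qed
qed

text \<open>The difference quotient of \<open>V \<Phi>\<close> at \<open>z\<close> can be rewritten by linearity of \<open>V\<close> on \<open>F\<close> only where
  \<open>\<Phi> w\<close> takes values in \<open>F\<close>, that is for \<open>w\<close> in the disc.\<close>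

lemma contractive_analytic_compose_unitary:
  assumes F: "closed_csubspace F" and V: "unitary_on F G V" and \<Phi>: "contractive_analytic E F \<Phi>"
  shows "contractive_analytic E G (\<lambda>z x. V (\<Phi> z x))"
proof -
  note V' = unitary_onD[OF V]
  have V_diff: "V (x - y) = V x - V y" if "x \<in> F" "y \<in> F" for x y
    using V'(1)[of "x - y" y] closed_csubspaceD(5)[OF F that] that by simp
  have bop: "bounded_op E G (\<lambda>x. V (A x))" if A: "bounded_op E F A" for A
  proof -
    obtain K where "\<forall>x\<in>E. norm (A x) \<le> K * norm x" using bounded_op_bound[OF A] by blast
    then show ?thesis
      unfolding bounded_op_def clinear_on_def
      by (intro conjI exI[of _ K])
         (auto simp: bounded_opD[OF A] V'(1,2,3) unitary_on_norm[OF V])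
  qed
  have \<Phi>b: "bounded_op E F (\<Phi> z)" if "z \<in> ball 0 1" for z
    using \<Phi> that unfolding contractive_analytic_def analytic_op_fun_def by blast
  show ?thesis
    unfolding contractive_analytic_def analytic_op_fun_def contraction_on_def
  proof (intro conjI ballI)
    fix z :: complex assume z: "z \<in> ball 0 1"
    show "bounded_op E G (\<lambda>x. V (\<Phi> z x))" by (rule bop[OF \<Phi>b[OF z]])
    show "norm (V (\<Phi> z x)) \<le> norm x" if "x \<in> E" for x
      using \<Phi> z that bounded_opD(1)[OF \<Phi>b[OF z] that]
      by (simp add: unitary_on_norm[OF V] contractive_analytic_def contraction_on_def)
    obtain A where A: "bounded_op E F A" and lim: "\<And>\<epsilon>. \<epsilon> > 0 \<Longrightarrow> \<forall>\<^sub>F w in at z. \<forall>x\<in>E.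
        norm ((1 / (w - z)) *\<^sub>C (\<Phi> w x - \<Phi> z x) - A x) \<le> \<epsilon> * norm x"
      using \<Phi> z unfolding contractive_analytic_def analytic_op_fun_def by meson
    show "\<exists>D. bounded_op E G D \<and> (\<forall>\<epsilon>>0. \<forall>\<^sub>F w in at z. \<forall>x\<in>E.
        norm ((1 / (w - z)) *\<^sub>C (V (\<Phi> w x) - V (\<Phi> z x)) - D x) \<le> \<epsilon> * norm x)"
    proof (intro exI[of _ "\<lambda>x. V (A x)"] conjI allI impI bop[OF A])
      fix \<epsilon> :: real assume "\<epsilon> > 0"
      have "\<forall>\<^sub>F w in at z. w \<in> ball 0 1" by (rule eventually_at_in_open'[OF open_ball z])
      with lim[OF \<open>\<epsilon> > 0\<close>] show "\<forall>\<^sub>F w in at z. \<forall>x\<in>E.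
        norm ((1 / (w - z)) *\<^sub>C (V (\<Phi> w x) - V (\<Phi> z x)) - V (A x)) \<le> \<epsilon> * norm x"
      proof eventually_elim
        case (elim w)
        show ?case
        proof
          fix x assume x: "x \<in> E"
          have in_F: "\<Phi> w x \<in> F" "\<Phi> z x \<in> F" "A x \<in> F"
            using bounded_opD(1)[OF \<Phi>b[OF elim(2)] x] bounded_opD(1)[OF \<Phi>b[OF z] x]
              bounded_opD(1)[OF A x] .
          note F' = closed_csubspaceD[OF F]
          have "(1 / (w - z)) *\<^sub>C (V (\<Phi> w x) - V (\<Phi> z x)) - V (A x)
              = V ((1 / (w - z)) *\<^sub>C (\<Phi> w x - \<Phi> z x) - A x)"
            by (simp add: V_diff V'(2) F' in_F)
          then show "norm ((1 / (w - z)) *\<^sub>C (V (\<Phi> w x) - V (\<Phi> z x)) - V (A x)) \<le> \<epsilon> * norm x"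
            using elim(1) x in_F F'(4,5) by (simp add: unitary_on_norm[OF V])
        qed
      qed
    qed
  qed
qed

lemma conjugation_bounded_linear:
  assumes C: "conjugation_on UNIV C"
  shows "bounded_linear C"
proof (rule bounded_linear_intro)
  note C' = conjugation_imp_antiunitary[OF C]
  show "norm (C x) \<le> norm x * 1" for x using antiunitary_on_norm[OF C', of x] by simp
  show "C (x + y) = C x + C y" "C (r *\<^sub>R x) = r *\<^sub>R C x" for x y r
    using antiunitary_onD(1,2)[OF C'] by (simp_all add: scaleR_scaleC)
qed


section \<open>Uniqueness of power series coefficients\<close>

text \<open>Subtract the two series, divide by the leading power of \<open>z\<close> and let \<open>z\<close> tend to \<open>0\<close>.\<close>

lemma power_series_coeffs_eq:
  fixes a b :: "nat \<Rightarrow> complex"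
  assumes a: "\<And>z. cmod z < 1 \<Longrightarrow> (\<lambda>n. a n * z ^ n) sums f z"
    and b: "\<And>z. cmod z < 1 \<Longrightarrow> (\<lambda>n. b n * z ^ n) sums f z"
  shows "a n = b n"
proof (induction n rule: less_induct)
  case (less n)
  have "(\<lambda>m. (a (m + n) - b (m + n)) * z ^ m) sums 0" if "z \<noteq> 0" "cmod z < 1" for z
  proof -
    have "(\<lambda>m. a m * z ^ m - b m * z ^ m) sums (f z - f z)"
      using that by (intro sums_diff a b)
    then have "(\<lambda>m. (a m - b m) * z ^ m) sums 0" by (simp add: left_diff_distrib)
    then have "(\<lambda>m. (a (m + n) - b (m + n)) * z ^ (m + n)) sums 0"
      using less by (subst sums_zero_iff_shift) auto
    then have "(\<lambda>m. inverse (z ^ n) * ((a (m + n) - b (m + n)) * z ^ (m + n)))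
        sums (inverse (z ^ n) * 0)"
      by (rule sums_mult)
    moreover have "inverse (z ^ n) * (c * z ^ (m + n)) = c * z ^ m" for m c
      using that by (simp add: power_add)
    ultimately show ?thesis by simp
  qed
  then have "((\<lambda>z. 0) \<longlongrightarrow> a (0 + n) - b (0 + n)) (at (0::complex))"
    by (intro powser_limit_0_strong[of 1]) auto
  then show ?case using tendsto_unique[OF at_neq_bot _ tendsto_const] by fastforce
qed


section \<open>A contraction with its defect operators\<close>

lemma bounded_op_UNIV_simps:
  assumes "bounded_op UNIV UNIV A"
  shows "A (x + y) = A x + A y" "A (c *\<^sub>C x) = c *\<^sub>C A x" "A (x - y) = A x - A y" "A (- x) = - A x"
    "A 0 = 0"
proof -
  interpret bounded_linear A by (rule bounded_op_UNIV_linear[OF assms])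
  show "A (x + y) = A x + A y" "A (x - y) = A x - A y" "A (- x) = - A x" "A 0 = 0"
    by (fact add diff neg zero)+
  show "A (c *\<^sub>C x) = c *\<^sub>C A x" using bounded_opD[OF assms] by simp
qed

lemma bounded_linear_image_closure:
  assumes "bounded_linear f" "f ` S \<subseteq> closure V" "x \<in> closure S"
  shows "f x \<in> closure V"
  using image_closure_subset[OF linear_continuous_on[OF assms(1)] closed_closure assms(2)] assms(3)
  by blast

text \<open>These relations are invariant under the exchange of \<open>T\<close>, \<open>D\<close> with the adjoint \<open>T'\<close> and its defect
  operator \<open>D'\<close>, so that each fact has a mirror image, with prefix \<open>dual\<close>. The mirror images of new
  facts become available whenever the context is reopened.\<close>

locale defect_pair =
  fixes T T' D D' :: "'h::chilbert_space \<Rightarrow> 'h"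
  assumes T: "bounded_op UNIV UNIV T" and T': "bounded_op UNIV UNIV T'"
    and D: "bounded_op UNIV UNIV D" and D': "bounded_op UNIV UNIV D'"
    and T_adj: "cinner (T x) y = cinner x (T' y)"
    and D_sym: "cinner (D x) y = cinner x (D y)"
    and D'_sym: "cinner (D' x) y = cinner x (D' y)"
    and DD: "D (D x) = x - T' (T x)"
    and D'D': "D' (D' x) = x - T (T' x)"
    and TD: "T (D x) = D' (T x)"
begin

lemma T'_adj: "cinner (T' x) y = cinner x (T y)"
  by (metis T_adj cinner_commute)

lemma T'D': "T' (D' x) = D (T' x)"
  by (rule eq_if_cinner_eq) (metis T_adj D_sym D'_sym TD)

end

sublocale defect_pair \<subseteq> dual: defect_pair T' T D' D
  by unfold_locales (fact T' T D' D T'_adj D'_sym D_sym D'D' DD T'D')+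

context defect_pair
begin

lemmas lin = bounded_op_UNIV_simps[OF T] bounded_op_UNIV_simps[OF T']
  bounded_op_UNIV_simps[OF D] bounded_op_UNIV_simps[OF D']

lemma T_pow_adj: "cinner ((T ^^ n) x) y = cinner x ((T' ^^ n) y)"
  by (induction n arbitrary: y) (simp_all add: T_adj funpow_swap1[of T'])

lemma T_gram: "cinner (T x) (T y) = cinner x y - cinner (D x) (D y)"
  by (simp add: T_adj D_sym DD cinner_diff_right)

lemma norm_T_sq: "(norm (T x))\<^sup>2 = (norm x)\<^sup>2 - (norm (D x))\<^sup>2"
proof -
  have "complex_of_real ((norm (T x))\<^sup>2) = of_real ((norm x)\<^sup>2 - (norm (D x))\<^sup>2)"
    using T_gram[of x x] by (simp only: cinner_self of_real_diff)
  then show ?thesis by (simp only: of_real_eq_iff)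
qed

lemma T_le: "norm (T x) \<le> norm x"
  by (rule power2_le_imp_le) (use norm_T_sq[of x] in auto)

lemma D_le: "norm (D x) \<le> norm x"
proof (rule power2_le_imp_le)
  show "(norm (D x))\<^sup>2 \<le> (norm x)\<^sup>2"
    using norm_T_sq[of x] zero_le_power2[of "norm (T x)"] by linarith
qed simp

abbreviation DT :: "'h set" where "DT \<equiv> closure (range D)"
abbreviation DT' :: "'h set" where "DT' \<equiv> closure (range D')"

lemma DT_subspace: "closed_csubspace DT"
proof (rule closed_csubspace_closure)
  show "complex_vector.subspace (range D)"
    unfolding complex_vector.subspace_def
  proof (intro conjI ballI allI)
    show "0 \<in> range D" using lin(15) by (metis rangeI)
    show "u + v \<in> range D" if "u \<in> range D" "v \<in> range D" for u v
      using that by (auto simp flip: lin)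
    show "c *\<^sub>C u \<in> range D" if "u \<in> range D" for c u
      using that by (auto simp flip: lin)
  qed
qed

lemma D_in: "D x \<in> DT"
  by (rule subsetD[OF closure_subset]) simp

lemma D_eq_0_if_perp:
  assumes "\<And>x. x \<in> DT \<Longrightarrow> cinner (D h) x = 0"
  shows "D h = 0"
  using assms[OF D_in[of h]] by simp

lemma D_inj_on_DT:
  assumes "x \<in> DT" "D x = 0"
  shows "x = 0"
proof -
  obtain f where f: "\<forall>n. f n \<in> range D" "f \<longlonglongrightarrow> x" using assms(1) by (meson closure_sequential)
  have "cinner (f n) x = 0" for n
    using f(1) assms(2) by (metis D_sym cinner_zero_right rangeE)
  then have "(\<lambda>n. 0) \<longlonglongrightarrow> cinner x x" using tendsto_cinner[OF f(2) tendsto_const[of x]] by simp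
  from LIMSEQ_unique[OF this tendsto_const] show ?thesis by simp
qed

end

context defect_pair
begin

lemma T_DT: "x \<in> DT \<Longrightarrow> T x \<in> DT'"
  by (rule bounded_linear_image_closure[OF bounded_op_UNIV_linear[OF T], of "range D"])
     (auto simp: TD dual.D_in)

text \<open>The Taylor coefficients of the characteristic function at \<open>0\<close> (\<open>\<Theta>_sums\<close>).\<close>

definition coef :: "nat \<Rightarrow> 'h \<Rightarrow> 'h" where
  "coef k x = (case k of 0 \<Rightarrow> - T x | Suc n \<Rightarrow> D' ((T' ^^ n) (D x)))"

lemma coef_simps [simp]: "coef 0 x = - T x" "coef (Suc n) x = D' ((T' ^^ n) (D x))"
  by (simp_all add: coef_def)

end

context defect_pair
begin

lemma coef_adj: "cinner (coef k x) y = cinner x (dual.coef k y)"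
  by (cases k) (simp_all add: cinner_simps T_adj D'_sym D_sym dual.T_pow_adj)

lemma coef_in: "x \<in> DT \<Longrightarrow> coef k x \<in> DT'"
proof (cases k)
  case 0
  assume "x \<in> DT"
  then show ?thesis
    using closed_csubspaceD(4)[OF dual.DT_subspace T_DT, of x "-1"] 0
    by (simp flip: scaleC_minus1)
qed (simp add: dual.D_in)


section \<open>The characteristic function\<close>

text \<open>The Neumann series of the resolvent \<open>(I - z T')\<^sup>-\<^sup>1\<close>.\<close>

definition res :: "complex \<Rightarrow> 'h \<Rightarrow> 'h" where
  "res z x = (\<Sum>n. z ^ n *\<^sub>C (T' ^^ n) x)"

lemma T'_pow_le: "norm ((T' ^^ n) x) \<le> norm x"
  by (induction n) (auto intro: order_trans[OF dual.T_le])

lemma res_sums: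
  assumes "cmod z < 1"
  shows "(\<lambda>n. z ^ n *\<^sub>C (T' ^^ n) x) sums res z x"
  unfolding res_def
proof (rule summable_sums, rule summable_comparison_test')
  show "summable (\<lambda>n. cmod z ^ n * norm x)"
    using assms by (intro summable_mult2 summable_geometric) simp
  show "norm (z ^ n *\<^sub>C (T' ^^ n) x) \<le> cmod z ^ n * norm x" for n
    by (simp add: norm_scaleC norm_power mult_left_mono T'_pow_le)
qed

lemma res_eq:
  assumes "cmod z < 1"
  shows "res z x - z *\<^sub>C T' (res z x) = x"
proof -
  have bl: "bounded_linear (\<lambda>x. z *\<^sub>C T' x)"
    using bounded_linear_compose[OF bounded_linear_scaleC bounded_op_UNIV_linear[OF T']] .
  have "(\<lambda>n. z ^ Suc n *\<^sub>C (T' ^^ Suc n) x) sums (z *\<^sub>C T' (res z x))"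
    using bounded_linear.sums[OF bl res_sums[OF assms, of x]]
    by (simp add: lin scaleC_scaleC)
  from sums_Suc[OF this] have "(\<lambda>n. z ^ n *\<^sub>C (T' ^^ n) x) sums (z *\<^sub>C T' (res z x) + x)"
    by (simp add: scaleC_one)
  then have "res z x = z *\<^sub>C T' (res z x) + x" using res_sums[OF assms] sums_unique2 by blast
  then show ?thesis by (simp add: algebra_simps)
qed

lemma res_bound:
  assumes z: "cmod z < 1" and x: "y - z *\<^sub>C T' y = x"
  shows "norm y \<le> norm x / (1 - cmod z)"
proof -
  have "norm y \<le> norm x + norm (z *\<^sub>C T' y)"
    using norm_triangle_ineq[of x "z *\<^sub>C T' y"] x by auto
  also have "norm (z *\<^sub>C T' y) \<le> cmod z * norm y"
    by (simp add: norm_scaleC mult_left_mono dual.T_le)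
  finally show ?thesis using z by (simp add: field_simps)
qed

lemma res_unique:
  assumes z: "cmod z < 1" and y: "y - z *\<^sub>C T' y = x"
  shows "y = res z x"
proof -
  have "(y - res z x) - z *\<^sub>C T' (y - res z x) = (y - z *\<^sub>C T' y) - (res z x - z *\<^sub>C T' (res z x))"
    by (simp add: lin complex_vector.scale_right_diff_distrib)
  also have "\<dots> = 0" using y res_eq[OF z] by simp
  finally show ?thesis using res_bound[OF z, of "y - res z x" 0] by simp
qed

lemma inv_eq_res:
  assumes "cmod z < 1"
  shows "inv (\<lambda>y. y - z *\<^sub>C T' y) x = res z x"
proof (rule inv_f_eq)
  show "inj (\<lambda>y. y - z *\<^sub>C T' y)" by (rule injI) (metis res_unique[OF assms])
qed (rule res_eq[OF assms])

lemma res_bounded: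
  assumes z: "cmod z < 1"
  shows "bounded_op UNIV UNIV (res z)"
proof (rule bounded_op_UNIV_I)
  show "norm (res z x) \<le> (1 / (1 - cmod z)) * norm x" for x
    using res_bound[OF z res_eq[OF z], of x] by simp
  show "res z (x + y) = res z x + res z y" for x y
  proof (intro res_unique[OF z, symmetric])
    have "(res z x + res z y) - z *\<^sub>C T' (res z x + res z y)
        = (res z x - z *\<^sub>C T' (res z x)) + (res z y - z *\<^sub>C T' (res z y))"
      by (simp add: lin scaleC_add_right)
    then show "(res z x + res z y) - z *\<^sub>C T' (res z x + res z y) = x + y"
      by (simp add: res_eq[OF z])
  qed
  show "res z (c *\<^sub>C x) = c *\<^sub>C res z x" for c x
  proof (intro res_unique[OF z, symmetric])
    have "c *\<^sub>C res z x - z *\<^sub>C T' (c *\<^sub>C res z x) = c *\<^sub>C (res z x - z *\<^sub>C T' (res z x))"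
      by (simp add: lin complex_vector.scale_right_diff_distrib scaleC_scaleC mult.commute)
    then show "c *\<^sub>C res z x - z *\<^sub>C T' (c *\<^sub>C res z x) = c *\<^sub>C x" by (simp add: res_eq[OF z])
  qed
qed

definition \<Theta> :: "complex \<Rightarrow> 'h \<Rightarrow> 'h" where
  "\<Theta> z x = - T x + z *\<^sub>C D' (res z (D x))"

lemma \<Theta>_sums:
  assumes "cmod z < 1"
  shows "(\<lambda>k. cinner (coef k x) y * z ^ k) sums cinner (\<Theta> z x) y"
proof -
  have bl: "bounded_linear (\<lambda>w. cinner (z *\<^sub>C D' w) y)"
    using bounded_linear_compose[OF bounded_bilinear.bounded_linear_left[OF bounded_bilinear_cinner]
        bounded_linear_compose[OF bounded_linear_scaleC bounded_op_UNIV_linear[OF D']]] .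
  have "(\<lambda>k. cinner (coef (Suc k) x) y * z ^ Suc k) sums cinner (z *\<^sub>C D' (res z (D x))) y"
    using bounded_linear.sums[OF bl res_sums[OF assms, of "D x"]]
    by (simp add: lin cinner_simps ac_simps)
  from sums_Suc[OF this] show ?thesis by (simp add: \<Theta>_def cinner_simps)
qed

lemma \<Theta>_bounded:
  assumes z: "cmod z < 1"
  shows "bounded_op DT DT' (\<Theta> z)"
proof -
  note R = bounded_op_UNIV_simps[OF res_bounded[OF z]]
  have "\<Theta> z x \<in> DT'" if "x \<in> DT" for x
    using coef_in[OF that, of 0] closed_csubspaceD(3,4)[OF dual.DT_subspace] dual.D_in
    unfolding \<Theta>_def coef_simps by blast
  moreover have "clinear_on DT (\<Theta> z)"
    unfolding clinear_on_def \<Theta>_def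
    by (simp add: lin R scaleC_add_right scaleC_scaleC mult.commute
        complex_vector.scale_right_diff_distrib)
  moreover have "norm (\<Theta> z x) \<le> (1 + cmod z / (1 - cmod z)) * norm x" for x
  proof -
    have "norm (\<Theta> z x) \<le> norm (T x) + norm (z *\<^sub>C D' (res z (D x)))"
      unfolding \<Theta>_def using norm_triangle_ineq[of "- T x"] by simp
    moreover have "norm (z *\<^sub>C D' (res z (D x))) \<le> cmod z * (norm x / (1 - cmod z))"
    proof -
      have "norm (D' (res z (D x))) \<le> norm (D x) / (1 - cmod z)"
        using dual.D_le res_bound[OF z res_eq[OF z]] order_trans by blast
      also have "\<dots> \<le> norm x / (1 - cmod z)" using z by (intro divide_right_mono D_le) simp
      finally show ?thesis unfolding norm_scaleC by (rule mult_left_mono) simp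
    qed
    ultimately show ?thesis using T_le[of x] by (simp add: algebra_simps)
  qed
  ultimately show ?thesis unfolding bounded_op_def by blast
qed

text \<open>In operator form, \<open>I - \<Theta>(z)\<^sup>* \<Theta>(z) = (1 - |z|\<^sup>2) D R\<^sup>* R D\<close> with the resolvent \<open>R = (I - z T')\<^sup>-\<^sup>1\<close>.\<close>

lemma norm_\<Theta>_sq:
  assumes z: "cmod z < 1"
  shows "(norm (\<Theta> z x))\<^sup>2 = (norm x)\<^sup>2 - (1 - (cmod z)\<^sup>2) * (norm (res z (D x)))\<^sup>2"
proof -
  define w where "w = res z (D x)"
  have w: "z *\<^sub>C T' w = w - D x" using res_eq[OF z, of "D x"] by (simp add: w_def algebra_simps)
  have "cinner (T x) (z *\<^sub>C D' w) = cinner (D x) (z *\<^sub>C T' w)"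
    by (simp add: cinner_scaleC_right TD flip: D'_sym T_adj)
  then have "Re (cinner (T x) (z *\<^sub>C D' w)) = Re (cinner (D x) w) - (norm (D x))\<^sup>2"
    by (simp add: w cinner_diff_right cinner_self)
  moreover have "(norm (z *\<^sub>C D' w))\<^sup>2 = (cmod z)\<^sup>2 * (norm w)\<^sup>2 - (norm (z *\<^sub>C T' w))\<^sup>2"
    by (simp add: norm_scaleC power_mult_distrib dual.norm_T_sq right_diff_distrib)
  moreover have "(norm (z *\<^sub>C T' w))\<^sup>2 = (norm w)\<^sup>2 - 2 * Re (cinner (D x) w) + (norm (D x))\<^sup>2"
    unfolding w using norm_add_sq[of "- D x" w] by (simp add: cinner_minus_left)
  ultimately show ?thesis
    using norm_add_sq[of "- T x" "z *\<^sub>C D' w"] norm_T_sq[of x]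
    by (simp add: \<Theta>_def cinner_minus_left algebra_simps flip: w_def)
qed

lemma \<Theta>_contractive:
  assumes z: "cmod z < 1"
  shows "norm (\<Theta> z x) \<le> norm x"
proof (rule power2_le_imp_le)
  have "(cmod z)\<^sup>2 \<le> 1" using z by (simp add: power_le_one)
  then show "(norm (\<Theta> z x))\<^sup>2 \<le> (norm x)\<^sup>2" by (simp add: norm_\<Theta>_sq[OF z])
qed simp

lemma res_diff:
  assumes z: "cmod z < 1" and w: "cmod w < 1"
  shows "res w x - res z x = (w - z) *\<^sub>C res w (T' (res z x))"
    and "w *\<^sub>C res w x - z *\<^sub>C res z x = (w - z) *\<^sub>C res w (res z x)"
proof -
  note R = bounded_op_UNIV_simps[OF res_bounded[OF w]]
  define v where "v = res z x"
  define b where "b = res w (T' v)"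
  have "v - z *\<^sub>C T' v = x" using res_eq[OF z] by (simp add: v_def)
  from arg_cong[OF this, of "res w"] have x: "res w x = res w v - z *\<^sub>C b" by (simp add: R b_def)
  have v: "res w v = v + w *\<^sub>C b"
    using res_unique[OF w refl, of v] by (simp add: R b_def algebra_simps)
  have "res w x - v = (w - z) *\<^sub>C b"
    by (simp add: x v complex_vector.scale_left_diff_distrib)
  then show "res w x - res z x = (w - z) *\<^sub>C res w (T' (res z x))" by (simp add: v_def b_def)
  have "w *\<^sub>C res w x - z *\<^sub>C v = (w - z) *\<^sub>C res w v"
    by (simp add: x v scaleC_add_right complex_vector.scale_left_diff_distrib
        complex_vector.scale_right_diff_distrib scaleC_scaleC mult.commute right_diff_distrib)
  then show "w *\<^sub>C res w x - z *\<^sub>C res z x = (w - z) *\<^sub>C res w (res z x)" by (simp add: v_def)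
qed

text \<open>By the resolvent identities the derivative is \<open>D' (I - z T')\<^sup>-\<^sup>2 D\<close>, and the error of the difference
  quotient carries the factor \<open>w - z\<close>.\<close>

lemma \<Theta>_contractive_analytic: "contractive_analytic DT DT' \<Theta>"
  unfolding contractive_analytic_def analytic_op_fun_def contraction_on_def
proof (intro conjI ballI)
  fix z :: complex assume "z \<in> ball 0 1"
  then have z: "cmod z < 1" by simp
  show "bounded_op DT DT' (\<Theta> z)" by (rule \<Theta>_bounded[OF z])
  show "norm (\<Theta> z x) \<le> norm x" for x by (rule \<Theta>_contractive[OF z])
  note R = bounded_op_UNIV_simps[OF res_bounded[OF z]]
  \<comment> \<open>\<open>K\<close> bounds all resolvents at points \<open>w\<close> with \<open>cmod w < r\<close>\<close>
  define r where "r = (1 + cmod z) / 2"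
  define K where "K = 1 / (1 - r)"
  have r: "cmod z < r" "r < 1" using z by (auto simp: r_def)
  have K: "K > 0" using r by (simp add: K_def)
  have bd: "norm (res w x) \<le> K * norm x" if "cmod w < r" for w x
  proof -
    have w: "cmod w < 1" using that r by simp
    have "norm x / (1 - cmod w) \<le> norm x / (1 - r)"
      using that r by (intro divide_left_mono) auto
    then show ?thesis using res_bound[OF w res_eq[OF w], of x] by (simp add: K_def)
  qed
  define Dv where "Dv = (\<lambda>x. D' (res z (res z (D x))))"
  show "\<exists>D. bounded_op DT DT' D \<and> (\<forall>\<epsilon>>0. \<forall>\<^sub>F w in at z. \<forall>x\<in>DT.
           norm ((1 / (w - z)) *\<^sub>C (\<Theta> w x - \<Theta> z x) - D x) \<le> \<epsilon> * norm x)"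
  proof (intro exI[of _ Dv] conjI allI impI)
    have "norm (Dv x) \<le> (K * K) * norm x" for x
    proof -
      have "norm (Dv x) \<le> K * norm (res z (D x))"
        unfolding Dv_def using dual.D_le bd[OF r(1)] order_trans by blast
      also have "\<dots> \<le> K * (K * norm (D x))" using K by (intro mult_left_mono bd r) simp
      also have "\<dots> \<le> K * (K * norm x)" using K by (intro mult_left_mono D_le) simp_all
      finally show ?thesis by simp
    qed
    then show "bounded_op DT DT' Dv"
      unfolding bounded_op_def clinear_on_def
      by (intro conjI exI[of _ "K * K"]) (auto simp: Dv_def lin R dual.D_in)
    fix \<epsilon> :: real assume \<epsilon>: "\<epsilon> > 0"
    define d where "d = min (r - cmod z) (\<epsilon> / (K * K * K))"
    have d: "d > 0" using \<epsilon> K r by (simp add: d_def)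
    show "\<forall>\<^sub>F w in at z. \<forall>x\<in>DT. norm ((1 / (w - z)) *\<^sub>C (\<Theta> w x - \<Theta> z x) - Dv x) \<le> \<epsilon> * norm x"
      unfolding eventually_at
    proof (intro exI[of _ d] conjI ballI impI d)
      fix w x assume wz: "w \<noteq> z \<and> dist w z < d"
      then have wz': "cmod (w - z) < r - cmod z" "cmod (w - z) \<le> \<epsilon> / (K * K * K)"
        by (auto simp: d_def dist_norm)
      have w: "cmod w < r" using wz'(1) norm_triangle_ineq[of "w - z" z] by simp
      then have w1: "cmod w < 1" using r by simp
      define v where "v = res z (D x)"
      have "\<Theta> w x - \<Theta> z x = D' (w *\<^sub>C res w (D x) - z *\<^sub>C res z (D x))"
        by (simp add: \<Theta>_def lin)
      also have "\<dots> = (w - z) *\<^sub>C D' (res w v)" by (simp add: res_diff(2)[OF z w1] lin v_def)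
      finally have "(1 / (w - z)) *\<^sub>C (\<Theta> w x - \<Theta> z x) - Dv x = D' (res w v - res z v)"
        using wz by (simp add: scaleC_scaleC scaleC_one Dv_def v_def lin)
      also have "\<dots> = (w - z) *\<^sub>C D' (res w (T' (res z v)))" by (simp add: res_diff(1)[OF z w1] lin)
      finally have "norm ((1 / (w - z)) *\<^sub>C (\<Theta> w x - \<Theta> z x) - Dv x)
          = cmod (w - z) * norm (D' (res w (T' (res z v))))" by (simp add: norm_scaleC)
      also have "\<dots> \<le> (\<epsilon> / (K * K * K)) * (K * (K * (K * norm x)))"
      proof (intro mult_mono wz')
        have "norm (D' (res w (T' (res z v)))) \<le> K * norm (T' (res z v))"
          using dual.D_le bd[OF w] order_trans by blast
        also have "\<dots> \<le> K * norm (res z v)" using K by (intro mult_left_mono dual.T_le) simp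
        also have "\<dots> \<le> K * (K * norm v)" using K by (intro mult_left_mono bd r) simp
        also have "\<dots> \<le> K * (K * (K * norm (D x)))"
          unfolding v_def using K by (intro mult_left_mono bd r) simp_all
        also have "\<dots> \<le> K * (K * (K * norm x))" using K by (intro mult_left_mono D_le) simp_all
        finally show "norm (D' (res w (T' (res z v)))) \<le> K * (K * (K * norm x))" .
      qed (use \<epsilon> K in simp_all)
      also have "\<dots> = \<epsilon> * norm x" using K by (simp add: field_simps)
      finally show "norm ((1 / (w - z)) *\<^sub>C (\<Theta> w x - \<Theta> z x) - Dv x) \<le> \<epsilon> * norm x" .
    qed
  qed
qed

lemma \<Theta>_pure: "pure_on DT \<Theta>"
  unfolding pure_on_def
proof (intro ballI impI)
  fix h assume "h \<in> DT" "h \<noteq> 0"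
  then have "norm (D h) > 0" using D_inj_on_DT by auto
  then have "(norm (T h))\<^sup>2 < (norm h)\<^sup>2" by (simp add: norm_T_sq)
  then have "norm (T h) < norm h" by (simp add: power2_less_imp_less)
  then show "norm (\<Theta> 0 h) < norm h" by (simp add: \<Theta>_def)
qed

lemma \<Theta>_symmetric_iff:
  "(\<forall>z\<in>ball 0 1. \<forall>u\<in>DT. \<forall>x\<in>DT. cinner (\<Theta> z u) (J x) = cinner (\<Theta> z x) (J u)) \<longleftrightarrow>
   (\<forall>k. \<forall>u\<in>DT. \<forall>x\<in>DT. cinner (coef k u) (J x) = cinner (coef k x) (J u))"
proof (intro iffI allI ballI)
  fix k u x
  assume sym: "\<forall>z\<in>ball 0 1. \<forall>u\<in>DT. \<forall>x\<in>DT. cinner (\<Theta> z u) (J x) = cinner (\<Theta> z x) (J u)"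
    and u: "u \<in> DT" and x: "x \<in> DT"
  show "cinner (coef k u) (J x) = cinner (coef k x) (J u)"
  proof (rule power_series_coeffs_eq)
    fix z :: complex assume z: "cmod z < 1"
    show "(\<lambda>k. cinner (coef k u) (J x) * z ^ k) sums cinner (\<Theta> z u) (J x)" by (rule \<Theta>_sums[OF z])
    show "(\<lambda>k. cinner (coef k x) (J u) * z ^ k) sums cinner (\<Theta> z u) (J x)"
      using \<Theta>_sums[OF z, of x "J u"] sym u x z by simp
  qed
next
  fix z :: complex and u x
  assume sym: "\<forall>k. \<forall>u\<in>DT. \<forall>x\<in>DT. cinner (coef k u) (J x) = cinner (coef k x) (J u)"
    and z: "z \<in> ball 0 1" and u: "u \<in> DT" and x: "x \<in> DT"
  have "(\<lambda>k. cinner (coef k x) (J u) * z ^ k) sums cinner (\<Theta> z u) (J x)"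
    using \<Theta>_sums[of z u "J x"] sym u x z by simp
  then show "cinner (\<Theta> z u) (J x) = cinner (\<Theta> z x) (J u)"
    using \<Theta>_sums[of z x "J u"] z sums_unique2 by simp
qed

end


section \<open>The unitary part\<close>

context defect_pair
begin

text \<open>The summand of \<open>T\<close> in its canonical decomposition: \<open>T\<close> and \<open>T'\<close> are mutually inverse there, and it
  is the orthogonal complement of all \<open>T\<^sup>n D' x\<close> and \<open>T'\<^sup>n D x\<close>.\<close>

definition unitary_part :: "'h set" where
  "unitary_part = {h. \<forall>n. D ((T ^^ n) h) = 0 \<and> D' ((T' ^^ n) h) = 0}"

lemma unitary_partD:
  assumes "h \<in> unitary_part"
  shows "D ((T ^^ n) h) = 0" "D' ((T' ^^ n) h) = 0" "D h = 0" "D' h = 0"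
    "T' (T h) = h" "T (T' h) = h"
proof -
  have *: "D ((T ^^ n) h) = 0" "D' ((T' ^^ n) h) = 0" for n
    using assms by (auto simp: unitary_part_def)
  show "D ((T ^^ n) h) = 0" "D' ((T' ^^ n) h) = 0" by (fact *)+
  show h: "D h = 0" "D' h = 0" using *[of 0] by simp_all
  show "T' (T h) = h" "T (T' h) = h" using DD[of h] D'D'[of h] by (simp_all add: h lin)
qed

lemma T_unitary_part:
  assumes h: "h \<in> unitary_part"
  shows "T h \<in> unitary_part"
proof -
  have "D ((T ^^ n) (T h)) = 0" for n
    using unitary_partD(1)[OF h, of "Suc n"] by (simp add: funpow_swap1)
  moreover have "D' ((T' ^^ n) (T h)) = 0" for n
  proof (cases n)
    case 0
    then show ?thesis using TD[of h] unitary_partD(3)[OF h] by (simp add: lin)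
  next
    case (Suc m)
    then show ?thesis
      using unitary_partD(2,5)[OF h] by (simp add: funpow_Suc_right del: funpow.simps)
  qed
  ultimately show ?thesis by (simp add: unitary_part_def)
qed

end

context defect_pair
begin

lemma dual_unitary_part: "dual.unitary_part = unitary_part"
  unfolding unitary_part_def dual.unitary_part_def by blast

lemmas T'_unitary_part = dual.T_unitary_part[unfolded dual_unitary_part]

lemma T_pow_unitary_part: "h \<in> unitary_part \<Longrightarrow> (T ^^ n) h \<in> unitary_part"
  by (induction n) (simp_all add: T_unitary_part)

lemma T'_pow_unitary_part: "h \<in> unitary_part \<Longrightarrow> (T' ^^ n) h \<in> unitary_part"
  by (induction n) (simp_all add: T'_unitary_part)

lemma unitary_part_perp:
  assumes "h \<in> unitary_part"
  shows "cinner ((T' ^^ n) (D x)) h = 0" "cinner ((T ^^ n) (D' x)) h = 0"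
  using unitary_partD(1,2)[OF assms, of n]
  by (simp_all add: dual.T_pow_adj T_pow_adj D_sym D'_sym)

text \<open>On the unitary part \<open>T\<close> and \<open>T'\<close> are isometric, so both exponents can be lowered until one of
  them is \<open>0\<close>.\<close>

lemma unitary_part_cyclic_gram:
  assumes s: "s \<in> unitary_part" and t: "t \<in> unitary_part"
    and sym: "\<And>n. cinner ((T' ^^ n) s) t = cinner t ((T ^^ n) s)"
      "\<And>n. cinner ((T' ^^ n) t) s = cinner s ((T ^^ n) t)"
  shows "cinner ((T' ^^ n) s) ((T' ^^ m) t) = cinner ((T ^^ m) t) ((T ^^ n) s)"
proof (induction n arbitrary: m)
  case 0
  show ?case using sym(2)[of m] by (metis cinner_commute funpow_0)
next
  case (Suc n)
  show ?case
  proof (cases m)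
    case 0
    then show ?thesis using sym(1)[of "Suc n"] by simp
  next
    case m: (Suc k)
    have "cinner (T' a) (T' b) = cinner a b" if "a \<in> unitary_part" for a b
      using dual.T_gram[of a b] unitary_partD(4)[OF that] by simp
    moreover have "cinner (T a) (T b) = cinner a b" if "a \<in> unitary_part" for a b
      using T_gram[of a b] unitary_partD(3)[OF that] by simp
    ultimately show ?thesis
      using Suc[of k] m s t by (simp add: T_pow_unitary_part T'_pow_unitary_part)
  qed
qed

text \<open>For vectors of the unitary part, this says that the reducing subspaces that they generate are
  orthogonal.\<close>

definition cyclic_perp :: "'h \<Rightarrow> 'h \<Rightarrow> bool" where
  "cyclic_perp s t \<longleftrightarrow> (\<forall>n. cinner ((T ^^ n) s) t = 0 \<and> cinner ((T' ^^ n) s) t = 0)"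

lemma cyclic_perp_sym:
  assumes "cyclic_perp s t"
  shows "cyclic_perp t s"
  unfolding cyclic_perp_def
proof (intro allI conjI)
  fix n
  have "cinner s ((T' ^^ n) t) = 0" "cinner s ((T ^^ n) t) = 0"
    using assms by (simp_all add: cyclic_perp_def T_pow_adj dual.T_pow_adj)
  then show "cinner ((T ^^ n) t) s = 0" "cinner ((T' ^^ n) t) s = 0"
    by (metis cinner_commute complex_cnj_zero)+
qed


section \<open>From the symmetry of the characteristic function to a conjugation\<close>

definition coef_symmetric :: "('h \<Rightarrow> 'h) \<Rightarrow> bool" where
  "coef_symmetric J \<longleftrightarrow>
     (\<forall>k. \<forall>u\<in>DT. \<forall>x\<in>DT. cinner (coef k u) (J x) = cinner (coef k x) (J u))"

lemma coef_symmetricD: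
  "coef_symmetric J \<Longrightarrow> u \<in> DT \<Longrightarrow> x \<in> DT \<Longrightarrow> cinner (coef k u) (J x) = cinner (coef k x) (J u)"
  unfolding coef_symmetric_def by blast

text \<open>A conjugation that exchanges \<open>T\<close> with \<open>T'\<close> and \<open>D\<close> with \<open>D'\<close> exchanges the defect spaces, and it
  reverses the order of the factors in \<open>D' T'\<^sup>n D\<close> while moving them across the form
  \<open>\<langle>a, C b\<rangle> = \<langle>b, C a\<rangle>\<close>.\<close>

lemma conjugation_imp_coef_symmetric:
  assumes C: "conjugation_on UNIV C" and CT: "\<And>x. C (T x) = T' (C x)"
    and CD: "\<And>x. C (D x) = D' (C x)"
  shows "antiunitary_on DT DT' C"
    and "cinner (coef k u) (C x) = cinner (coef k x) (C u)"
proof -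
  note C' = antiunitary_onD[OF conjugation_imp_antiunitary[OF C], simplified]
  have CC: "C (C x) = x" for x using C by (simp add: conjugation_on_def)
  have CT': "C (T' x) = T (C x)" for x using CT[of "C x"] by (metis CC)
  have CD': "C (D' x) = D (C x)" for x using CD[of "C x"] by (metis CC)
  note bl = conjugation_bounded_linear[OF C]
  have into: "x \<in> DT \<Longrightarrow> C x \<in> DT'" for x
    by (rule bounded_linear_image_closure[OF bl, of "range D"]) (auto simp: CD dual.D_in)
  have into': "x \<in> DT' \<Longrightarrow> C x \<in> DT" for x
    by (rule bounded_linear_image_closure[OF bl, of "range D'"]) (auto simp: CD' D_in)
  have "C ` DT = DT'"
  proof
    show "C ` DT \<subseteq> DT'" using into by blast
    show "DT' \<subseteq> C ` DT"
    proof
      fix y assume "y \<in> DT'"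
      then show "y \<in> C ` DT" using CC[of y] by (intro image_eqI[of _ _ "C y"] into') simp_all
    qed
  qed
  then show "antiunitary_on DT DT' C"
    using C by (auto simp: antiunitary_on_def conjugation_on_def antilinear_on_def)
  have C_swap: "cinner a (C b) = cinner b (C a)" for a b
    using C'(4)[of "C a" b] by (simp add: CC)
  show "cinner (coef k u) (C x) = cinner (coef k x) (C u)"
  proof (cases k)
    case 0
    have "cinner (T u) (C x) = cinner u (T' (C x))" by (rule T_adj)
    also have "\<dots> = cinner (T x) (C u)" using C_swap[of u "T x"] by (simp add: CT)
    finally show ?thesis using 0 by (simp add: cinner_minus_left)
  next
    case (Suc n)
    have pow: "C ((T' ^^ n) y) = (T ^^ n) (C y)" for y
      by (induction n) (simp_all add: CT')
    have "cinner (coef k u) (C x) = cinner (D u) ((T ^^ n) (C (D x)))"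
      by (simp add: Suc D'_sym dual.T_pow_adj CD)
    also have "\<dots> = cinner ((T' ^^ n) (D x)) (C (D u))"
      using C_swap[of "D u" "(T' ^^ n) (D x)"] by (simp add: pow)
    also have "\<dots> = cinner (coef k x) (C u)" by (simp add: Suc D'_sym CD)
    finally show ?thesis .
  qed
qed

text \<open>The operator form \<open>J \<Theta>\<^sub>k\<^sup>* J = \<Theta>\<^sub>k\<close> of the symmetry: the difference of both sides is orthogonal to
  the range of \<open>J\<close>, in which it lies.\<close>

lemma coef_conj_adj:
  assumes J: "antiunitary_on DT DT' J"
    and sym: "coef_symmetric J"
    and x: "x \<in> DT"
  shows "J (dual.coef k (J x)) = coef k x"
proof -
  define a where "a = dual.coef k (J x)"
  have a: "a \<in> DT" unfolding a_def by (rule dual.coef_in[OF antiunitary_onD(3)[OF J x]])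
  have perp: "cinner (J a - coef k x) (J u) = 0" if u: "u \<in> DT" for u
  proof -
    have "cinner (J a) (J u) = cinner u a" by (rule antiunitary_onD(4)[OF J a u])
    also have "\<dots> = cinner (coef k u) (J x)" by (simp add: a_def coef_adj)
    also have "\<dots> = cinner (coef k x) (J u)" by (rule coef_symmetricD[OF sym u x])
    finally show ?thesis by (simp add: cinner_diff_left)
  qed
  have "J a - coef k x \<in> DT'"
    by (intro closed_csubspaceD(5)[OF dual.DT_subspace] antiunitary_onD(3)[OF J a] coef_in x)
  then obtain v where "v \<in> DT" "J v = J a - coef k x" using antiunitary_onD(5)[OF J] by blast
  then show ?thesis using perp[of v] by (simp add: a_def)
qed

text \<open>The identity \<open>\<langle>T' a, T' b\<rangle> = \<langle>a, b\<rangle> - \<langle>D' a, D' b\<rangle>\<close> lowers both exponents by one. On the left it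
  splits off \<open>\<langle>\<Theta>\<^sub>n x, \<Theta>\<^sub>m y\<rangle>\<close> and on the right, in its mirror image, \<open>\<langle>\<Theta>\<^sub>m\<^sup>* J y, \<Theta>\<^sub>n\<^sup>* J x\<rangle>\<close>; these agree
  because \<open>J \<Theta>\<^sub>k\<^sup>* J = \<Theta>\<^sub>k\<close>.\<close>

lemma generator_gram:
  assumes J: "antiunitary_on DT DT' J"
    and sym: "coef_symmetric J"
    and x: "x \<in> DT" and y: "y \<in> DT"
  shows "cinner ((T' ^^ n) (D x)) ((T' ^^ m) (D y))
    = cinner ((T ^^ m) (D' (J y))) ((T ^^ n) (D' (J x)))"
proof -
  have gram_coef: "cinner (coef i x) (coef j y) = cinner (dual.coef j (J y)) (dual.coef i (J x))"
    if "x \<in> DT" "y \<in> DT" for i j x y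
  proof -
    have in_DT: "dual.coef k (J u) \<in> DT" if "u \<in> DT" for k u
      by (rule dual.coef_in[OF antiunitary_onD(3)[OF J that]])
    show ?thesis
      using antiunitary_onD(4)[OF J in_DT in_DT, OF that, of i j]
      by (simp only: coef_conj_adj[OF J sym that(1)] coef_conj_adj[OF J sym that(2)])
  qed
  have base: "cinner ((T' ^^ n) (D x)) (D y) = cinner (D' (J y)) ((T ^^ n) (D' (J x)))"
    if "x \<in> DT" "y \<in> DT" for n x y
  proof (cases n)
    case 0
    have "cinner (D x) (D y) = cinner x y - cinner (coef 0 x) (coef 0 y)"
      by (simp add: D_sym DD cinner_simps T_adj)
    moreover have "cinner (D' (J y)) (D' (J x))
        = cinner (J y) (J x) - cinner (dual.coef 0 (J y)) (dual.coef 0 (J x))"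
      by (simp add: D'_sym D'D' cinner_simps T'_adj)
    ultimately show ?thesis
      using 0 gram_coef[OF that, of 0 0] antiunitary_onD(4)[OF J that(2,1)] by simp
  next
    case (Suc k)
    have "cinner ((T' ^^ n) (D x)) (D y) = - cinner (coef n x) (coef 0 y)"
      by (simp add: Suc cinner_simps T'D' flip: D_sym T'_adj)
    moreover have "cinner (D' (J y)) ((T ^^ n) (D' (J x)))
        = - cinner (dual.coef 0 (J y)) (dual.coef n (J x))"
      by (simp add: Suc cinner_simps D'_sym T'_adj TD)
    ultimately show ?thesis using gram_coef[OF that, of n 0] by simp
  qed
  show ?thesis
  proof (induction n arbitrary: m)
    case 0
    have "cinner ((T' ^^ m) (D y)) (D x) = cinner (D' (J x)) ((T ^^ m) (D' (J y)))"
      by (rule base[OF y x])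
    then show ?case by (metis cinner_commute funpow_0)
  next
    case (Suc n)
    show ?case
    proof (cases m)
      case 0
      then show ?thesis using base[OF x y, of "Suc n"] by simp
    next
      case m: (Suc k)
      have "cinner ((T' ^^ Suc n) (D x)) ((T' ^^ m) (D y))
          = cinner ((T' ^^ n) (D x)) ((T' ^^ k) (D y)) - cinner (coef (Suc n) x) (coef m y)"
        by (simp add: m dual.T_gram)
      moreover have "cinner ((T ^^ m) (D' (J y))) ((T ^^ Suc n) (D' (J x)))
          = cinner ((T ^^ k) (D' (J y))) ((T ^^ n) (D' (J x)))
            - cinner (dual.coef m (J y)) (dual.coef (Suc n) (J x))"
        by (simp add: m T_gram)
      ultimately show ?thesis using Suc.IH[of k] gram_coef[OF x y, of "Suc n" m] by simp
    qed
  qed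
qed

text \<open>Both sides are a value of the form of the coefficient \<open>\<Theta>\<^sub>n\<^sub>+\<^sub>m\<^sub>+\<^sub>1\<close>.\<close>

lemma generator_gram_mixed:
  assumes sym: "coef_symmetric J"
    and "x \<in> DT" "y \<in> DT"
  shows "cinner ((T' ^^ n) (D x)) ((T ^^ m) (D' (J y)))
    = cinner ((T' ^^ m) (D y)) ((T ^^ n) (D' (J x)))"
proof -
  have eq: "cinner ((T' ^^ n) (D x)) ((T ^^ m) (D' v)) = cinner (coef (Suc (m + n)) x) v" for n m x v
  proof -
    have "cinner ((T' ^^ n) (D x)) ((T ^^ m) (D' v)) = cinner ((T' ^^ m) ((T' ^^ n) (D x))) (D' v)"
      by (rule dual.T_pow_adj[symmetric])
    then show ?thesis by (simp add: D'_sym funpow_add)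
  qed
  show ?thesis unfolding eq using coef_symmetricD[OF sym assms(2,3), of "Suc (m + n)"] by (simp add: add.commute)
qed

text \<open>The conjugation swaps \<open>T\<^sup>n D' J x\<close> with \<open>T'\<^sup>n D x\<close> and, on the unitary part, \<open>T\<^sup>n s\<close> with
  \<open>T'\<^sup>n s\<close> for \<open>s\<close> in a family of vectors whose cyclic reducing subspaces decompose it.\<close>

lemma conjugation_from_symmetric_coef:
  assumes J: "antiunitary_on DT DT' J"
    and sym: "coef_symmetric J"
  shows "\<exists>C. conjugation_on UNIV C \<and> (\<forall>x. C (T x) = T' (C x))"
proof -
  obtain S where S: "S \<subseteq> unitary_part"
    "\<And>s t. s \<in> S \<Longrightarrow> t \<in> S \<Longrightarrow> s \<noteq> t \<Longrightarrow> cyclic_perp s t"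
    "\<And>h. h \<in> unitary_part \<Longrightarrow> (\<And>s. s \<in> S \<Longrightarrow> cyclic_perp h s \<and> cyclic_perp s h) \<Longrightarrow> h \<in> S"
    using maximal_pairwise_subset[of unitary_part cyclic_perp] by metis
  define p q where "p n x = (T ^^ n) (D' (J x))" and "q n x = (T' ^^ n) (D x)" for n x
  define Q where "Q = {(p n x, q n x) | n x. x \<in> DT} \<union> {((T ^^ n) s, (T' ^^ n) s) | n s. s \<in> S}"
  define P where "P = Q \<union> Q\<inverse>"
  have Q_cases: "(\<exists>n x. x \<in> DT \<and> a = p n x \<and> b = q n x) \<or>
      (\<exists>n s. s \<in> S \<and> a = (T ^^ n) s \<and> b = (T' ^^ n) s)" if "(a, b) \<in> Q" for a b
    using that unfolding Q_def by blast
  have Q1: "(p n x, q n x) \<in> Q" if "x \<in> DT" for n x using that unfolding Q_def by blast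
  have Q2: "((T ^^ n) s, (T' ^^ n) s) \<in> Q" if "s \<in> S" for n s using that unfolding Q_def by blast
  have S_u: "s \<in> unitary_part" if "s \<in> S" for s using S(1) that by blast

  have perp_pq: "cinner (p n x) h = 0" "cinner (q n x) h = 0"
    "cinner h (p n x) = 0" "cinner h (q n x) = 0" if "h \<in> unitary_part" for n x h
    using unitary_part_perp[OF that] cinner_commute[of h] unfolding p_def q_def by simp_all
  have cyc: "cinner ((T' ^^ n) s) t = cinner t ((T ^^ n) s)" if "s \<in> S" "t \<in> S" for n s t
  proof (cases "s = t")
    case True
    then show ?thesis by (simp add: dual.T_pow_adj)
  next
    case False
    then have "cinner ((T' ^^ n) s) t = 0" "cinner ((T ^^ n) s) t = 0"
      using S(2)[OF that] unfolding cyclic_perp_def by blast+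
    then show ?thesis using cinner_commute[of t "(T ^^ n) s"] by simp
  qed
  have cyc2: "cinner ((T' ^^ n) s) t = cinner ((T' ^^ n) t) s" if "s \<in> S" "t \<in> S" for n s t
    using cyc[OF that, of n] by (simp add: dual.T_pow_adj)
  have gram1: "cinner b d = cinner c a" if "(a, b) \<in> Q" "(c, d) \<in> Q" for a b c d
    using Q_cases[OF that(1)] Q_cases[OF that(2)]
  proof (elim disjE exE conjE)
    fix n x m y assume "x \<in> DT" "a = p n x" "b = q n x" "y \<in> DT" "c = p m y" "d = q m y"
    then show ?thesis using generator_gram[OF J sym, of x y n m] by (simp add: p_def q_def)
  next
    fix n s m t assume *: "s \<in> S" "a = (T ^^ n) s" "b = (T' ^^ n) s"
      "t \<in> S" "c = (T ^^ m) t" "d = (T' ^^ m) t"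
    then show ?thesis
      using unitary_part_cyclic_gram[OF S_u[OF *(1)] S_u[OF *(4)] cyc[OF *(1,4)] cyc[OF *(4,1)]]
      by simp
  qed (simp_all add: perp_pq S_u T_pow_unitary_part T'_pow_unitary_part)
  have gram2: "cinner b c = cinner d a" if "(a, b) \<in> Q" "(c, d) \<in> Q" for a b c d
    using Q_cases[OF that(1)] Q_cases[OF that(2)]
  proof (elim disjE exE conjE)
    fix n x m y assume "x \<in> DT" "a = p n x" "b = q n x" "y \<in> DT" "c = p m y" "d = q m y"
    then show ?thesis using generator_gram_mixed[OF sym, of x y n m] by (simp add: p_def q_def)
  next
    fix n s m t assume *: "s \<in> S" "a = (T ^^ n) s" "b = (T' ^^ n) s"
      "t \<in> S" "c = (T ^^ m) t" "d = (T' ^^ m) t"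
    have "cinner ((T' ^^ n) u) ((T ^^ m) v) = cinner ((T' ^^ (m + n)) u) v" for n m u v
      using dual.T_pow_adj[of m "(T' ^^ n) u" v] by (simp add: funpow_add)
    then show ?thesis using cyc2[OF *(1,4), of "m + n"] * by (simp add: add.commute)
  qed (simp_all add: perp_pq S_u T_pow_unitary_part T'_pow_unitary_part)
  have gram: "cinner b d = cinner c a" if "(a, b) \<in> P" "(c, d) \<in> P" for a b c d
  proof -
    have "(a, b) \<in> Q \<or> (b, a) \<in> Q" "(c, d) \<in> Q \<or> (d, c) \<in> Q" using that unfolding P_def by auto
    then show ?thesis
    proof (elim disjE)
      assume "(b, a) \<in> Q" "(c, d) \<in> Q"
      then have "cinner d b = cinner a c" by (rule gram2[rotated])
      then show ?thesis by (metis cinner_commute)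
    next
      assume "(b, a) \<in> Q" "(d, c) \<in> Q"
      then show ?thesis by (rule gram1[symmetric, rotated])
    qed (fact gram1, fact gram2)
  qed
  have P_sym: "(b, a) \<in> P" if "(a, b) \<in> P" for a b using that unfolding P_def by auto

  have shift: "(T a, T' b) \<in> Q" if "(a, b) \<in> Q" for a b
    using Q_cases[OF that]
  proof (elim disjE exE conjE)
    fix n x assume "x \<in> DT" "a = p n x" "b = q n x"
    then show ?thesis using Q1[of x "Suc n"] by (simp add: p_def q_def)
  next
    fix n s assume "s \<in> S" "a = (T ^^ n) s" "b = (T' ^^ n) s"
    then show ?thesis using Q2[of s "Suc n"] by simp
  qed
  have in_closure: "(a, b) \<in> conj_closure P" if "(a, b) \<in> P" for a b
    by (rule conj_spanD[OF conj_span_base[OF that]])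
  \<comment> \<open>up to the defect, \<open>T\<close> and \<open>T'\<close> undo one step of each other, and the defect term is again a
    multiple of a generator pair because \<open>J \<Theta>\<^sub>n\<^sup>* J = \<Theta>\<^sub>n\<close>\<close>
  have unshift: "(T b, T' a) \<in> conj_closure P" if "(a, b) \<in> Q" for a b
    using Q_cases[OF that]
  proof (elim disjE exE conjE)
    fix n x assume x: "x \<in> DT" and a: "a = p n x" and b: "b = q n x"
    define y where "y = dual.coef n (J x)"
    have y: "y \<in> DT" unfolding y_def by (rule dual.coef_in[OF antiunitary_onD(3)[OF J x]])
    have Jy: "J y = coef n x" unfolding y_def by (rule coef_conj_adj[OF J sym x])
    have "(p 0 y, q 0 y) \<in> P" using Q1[OF y] unfolding P_def by blast
    then have "((-1) *\<^sub>C p 0 y, cnj (-1) *\<^sub>C q 0 y) \<in> conj_closure P"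
      by (intro conj_closure_scale in_closure)
    then have y_pair: "(- D' (coef n x), - D (dual.coef n (J x))) \<in> conj_closure P"
      using Jy by (simp add: p_def q_def y_def flip: scaleC_minus1)
    show ?thesis
    proof (cases n)
      case 0
      then show ?thesis using y_pair a b by (simp add: p_def q_def TD T'D' lin)
    next
      case (Suc m)
      have "(q m x, p m x) \<in> P" using Q1[OF x] unfolding P_def by blast
      from conj_closure_add[OF in_closure[OF this] y_pair]
      show ?thesis using a b by (simp add: Suc p_def q_def DD D'D')
    qed
  next
    fix n s assume s: "s \<in> S" and a: "a = (T ^^ n) s" and b: "b = (T' ^^ n) s"
    have "(T b, T' a) \<in> P"
    proof (cases n)
      case 0
      then show ?thesis using Q2[OF s, of 1] a b unfolding P_def by simp
    next
      case (Suc m)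
      then have "T b = (T' ^^ m) s" "T' a = (T ^^ m) s"
        using unitary_partD(5)[OF T_pow_unitary_part[OF S_u[OF s]], of m]
          unitary_partD(6)[OF T'_pow_unitary_part[OF S_u[OF s]], of m] a b by simp_all
      then show ?thesis using Q2[OF s, of m] unfolding P_def by simp
    qed
    then show ?thesis by (rule in_closure)
  qed
  have gen: "(T a, T' b) \<in> conj_closure P" if "(a, b) \<in> P" for a b
  proof (cases "(a, b) \<in> Q")
    case True
    then show ?thesis using shift[OF True] in_closure unfolding P_def by blast
  next
    case False
    then show ?thesis using that unshift[of b a] unfolding P_def by blast
  qed

  \<comment> \<open>a vector orthogonal to all generators lies in the unitary part, hence by maximality in \<open>S\<close>,
    and so it is orthogonal to itself\<close>
  have total: "h = 0" if perp: "\<And>a b. (a, b) \<in> P \<Longrightarrow> cinner a h = 0" for h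
  proof -
    have perp1: "cinner a h = 0" "cinner b h = 0" if "(a, b) \<in> Q" for a b
      using perp that unfolding P_def by blast+
    have "D' ((T' ^^ n) h) = 0" for n
    proof (rule dual.D_eq_0_if_perp)
      fix w assume "w \<in> DT'"
      then obtain x where x: "x \<in> DT" "J x = w" using antiunitary_onD(5)[OF J] by blast
      have "cinner w (D' ((T' ^^ n) h)) = 0"
        using perp1(1)[OF Q1[OF x(1)], of n] by (simp add: p_def x T_pow_adj D'_sym)
      then show "cinner (D' ((T' ^^ n) h)) w = 0" by (metis cinner_commute complex_cnj_zero)
    qed
    moreover have "D ((T ^^ n) h) = 0" for n
    proof (rule D_eq_0_if_perp)
      fix x assume x: "x \<in> DT"
      have "cinner x (D ((T ^^ n) h)) = 0"
        using perp1(2)[OF Q1[OF x], of n] by (simp add: q_def dual.T_pow_adj D_sym)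
      then show "cinner (D ((T ^^ n) h)) x = 0" by (metis cinner_commute complex_cnj_zero)
    qed
    ultimately have h: "h \<in> unitary_part" by (simp add: unitary_part_def)
    have perp_s: "cyclic_perp s h" if "s \<in> S" for s
      unfolding cyclic_perp_def using perp1[OF Q2[OF that]] by blast
    then have "h \<in> S" using S(3)[OF h] cyclic_perp_sym by blast
    then have "cyclic_perp h h" by (rule perp_s)
    then have "cinner ((T ^^ 0) h) h = 0" unfolding cyclic_perp_def by blast
    then show ?thesis by simp
  qed
  obtain C where C: "conjugation_on UNIV C" "\<And>x. x \<in> UNIV \<Longrightarrow> (x, C x) \<in> conj_closure P"
    "\<And>x y. (x, y) \<in> conj_closure P \<Longrightarrow> y = C x"
  proof (rule conjugation_from_pairs[of UNIV P])
    show "(b, a) \<in> P" if "(a, b) \<in> P" for a b by (rule P_sym[OF that])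
    show "cinner b d = cinner c a" if "(a, b) \<in> P" "(c, d) \<in> P" for a b c d by (rule gram[OF that])
    show "h = 0" if "\<And>a b. (a, b) \<in> P \<Longrightarrow> cinner a h = 0" for h by (rule total[OF that])
  qed (use that in auto)
  have "C (T x) = T' (C x)" for x
  proof -
    have "(T x, T' (C x)) \<in> conj_closure P"
      by (rule conj_closure_map[OF T T' gen C(2)]) simp_all
    then show ?thesis using C(3) by simp
  qed
  with C(1) show ?thesis by blast
qed


section \<open>Symmetric models\<close>

definition \<Theta>_symmetric :: "('h \<Rightarrow> 'h) \<Rightarrow> bool" where
  "\<Theta>_symmetric J \<longleftrightarrow> antiunitary_on DT DT' J \<and>
     (\<forall>z\<in>ball 0 1. \<forall>u\<in>DT. \<forall>x\<in>DT. cinner (\<Theta> z u) (J x) = cinner (\<Theta> z x) (J u))"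

lemma \<Theta>_in: "z \<in> ball 0 1 \<Longrightarrow> x \<in> DT \<Longrightarrow> \<Theta> z x \<in> DT'"
  using bounded_opD(1)[OF \<Theta>_bounded, of z x] by simp

text \<open>The unitary map \<open>V = C J\<^sup>-\<^sup>1\<close> identifies the two defect spaces in such a way that \<open>J\<close> becomes the
  chosen conjugation \<open>C\<close>: \<open>\<langle>V \<Theta>(z) u, C x\<rangle> = \<langle>\<Theta>(z) u, J x\<rangle>\<close>.\<close>

lemma symmetric_model_exists:
  assumes J: "\<Theta>_symmetric J"
  shows "\<exists>C \<Psi>. conjugation_on DT C \<and> contractive_analytic DT DT \<Psi> \<and> pure_on DT \<Psi> \<and>
    (\<forall>z\<in>ball 0 1. symmetric_on DT C (\<Psi> z)) \<and> coincide DT DT' \<Theta> DT DT \<Psi>"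
proof -
  have Ja: "antiunitary_on DT DT' J" using J by (simp add: \<Theta>_symmetric_def)
  obtain C where C: "conjugation_on DT C" using conjugation_on_exists[OF DT_subspace] .
  have Ca: "antiunitary_on DT DT C" by (rule conjugation_imp_antiunitary[OF C])
  define K where "K = inv_into DT J"
  have Ka: "antiunitary_on DT' DT K"
    unfolding K_def by (rule antiunitary_on_inv[OF DT_subspace dual.DT_subspace Ja])
  have JK: "J (K y) = y" if "y \<in> DT'" for y
    using Ja that unfolding antiunitary_on_def K_def by (auto intro: f_inv_into_f)
  define V where "V y = C (K y)" for y
  have V: "unitary_on DT' DT V"
    unfolding V_def by (rule antiunitary_antiunitary_comp[OF Ka Ca])
  define \<Psi> where "\<Psi> z x = V (\<Theta> z x)" for z x
  have \<Psi>: "contractive_analytic DT DT \<Psi>"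
    unfolding \<Psi>_def
    by (rule contractive_analytic_compose_unitary[OF dual.DT_subspace V \<Theta>_contractive_analytic])
  have "symmetric_on DT C (\<Psi> z)" if z: "z \<in> ball 0 1" for z
  proof -
    have b: "bounded_op DT DT (\<Psi> z)"
      using \<Psi> z unfolding contractive_analytic_def analytic_op_fun_def by blast
    have form: "cinner (\<Psi> z u) (C x) = cinner (\<Theta> z u) (J x)" if u: "u \<in> DT" and x: "x \<in> DT" for u x
    proof -
      have K_in: "K (\<Theta> z u) \<in> DT" by (rule antiunitary_onD(3)[OF Ka \<Theta>_in[OF z u]])
      have "cinner (\<Psi> z u) (C x) = cinner x (K (\<Theta> z u))"
        unfolding \<Psi>_def V_def by (rule antiunitary_onD(4)[OF Ca K_in x])
      also have "\<dots> = cinner (J (K (\<Theta> z u))) (J x)"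
        by (rule antiunitary_onD(4)[OF Ja K_in x, symmetric])
      finally show ?thesis by (simp add: JK \<Theta>_in[OF z u])
    qed
    have "\<forall>u\<in>DT. \<forall>x\<in>DT. cinner (\<Psi> z u) (C x) = cinner (\<Psi> z x) (C u)"
      using J z unfolding \<Theta>_symmetric_def by (simp add: form)
    then show ?thesis
      unfolding symmetric_on_def using adj_symmetric_iff[OF DT_subspace b Ca] by blast
  qed
  moreover have "pure_on DT \<Psi>"
    unfolding pure_on_def
  proof (intro ballI impI)
    fix h assume h: "h \<in> DT" "h \<noteq> 0"
    have "norm (\<Psi> 0 h) = norm (\<Theta> 0 h)"
      unfolding \<Psi>_def by (rule unitary_on_norm[OF V \<Theta>_in[OF _ h(1)]]) simp
    also have "\<dots> < norm h" using \<Theta>_pure h unfolding pure_on_def by blast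
    finally show "norm (\<Psi> 0 h) < norm h" .
  qed
  moreover have "coincide DT DT' \<Theta> DT DT \<Psi>"
    unfolding coincide_def
  proof (intro exI conjI ballI)
    show "unitary_on DT DT (\<lambda>x. x)" by (simp add: unitary_on_def clinear_on_def)
    show "unitary_on DT' DT V" by (rule V)
    fix z :: complex and x assume "z \<in> ball 0 1" "x \<in> DT"
    then show "\<Theta> z x = adj_on DT' V (\<Psi> z x)"
      unfolding \<Psi>_def by (simp only: adj_on_unitary[OF dual.DT_subspace V \<Theta>_in])
  qed
  ultimately show ?thesis using C \<Psi> by blast
qed

text \<open>For \<open>J = V\<^sup>* C U\<close> one has \<open>\<langle>\<Theta>(z) u, J x\<rangle> = \<langle>\<Psi>(z) U u, C U x\<rangle>\<close>.\<close>

lemma symmetric_if_model: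
  fixes E :: "'k::chilbert_space set"
  assumes E: "closed_csubspace E" and C: "conjugation_on E C"
    and \<Psi>: "contractive_analytic E E \<Psi>" and sym: "\<forall>z\<in>ball 0 1. symmetric_on E C (\<Psi> z)"
    and co: "coincide DT DT' \<Theta> E E \<Psi>"
  shows "\<exists>J. \<Theta>_symmetric J"
proof -
  obtain U V where U: "unitary_on DT E U" and V: "unitary_on DT' E V"
    and eq: "\<forall>z\<in>ball 0 1. \<forall>x\<in>DT. \<Theta> z x = adj_on DT' V (\<Psi> z (U x))"
    using co unfolding coincide_def by blast
  have Ca: "antiunitary_on E E C" by (rule conjugation_imp_antiunitary[OF C])
  have W: "unitary_on E DT' (adj_on DT' V)" by (rule unitary_on_adj[OF dual.DT_subspace V])
  define J where "J x = adj_on DT' V (C (U x))" for x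
  have "antiunitary_on DT DT' J"
    unfolding J_def by (rule unitary_antiunitary_comp[OF antiunitary_unitary_comp[OF U Ca] W])
  moreover have "cinner (\<Theta> z u) (J x) = cinner (\<Theta> z x) (J u)"
    if z: "z \<in> ball 0 1" and "u \<in> DT" "x \<in> DT" for z u x
  proof -
    have b: "bounded_op E E (\<Psi> z)"
      using \<Psi> z unfolding contractive_analytic_def analytic_op_fun_def by blast
    have s: "\<forall>u\<in>E. \<forall>x\<in>E. cinner (\<Psi> z u) (C x) = cinner (\<Psi> z x) (C u)"
      using adj_symmetric_iff[OF E b Ca] sym z unfolding symmetric_on_def by blast
    have form: "cinner (\<Theta> z u) (J x) = cinner (\<Psi> z (U u)) (C (U x))" if "u \<in> DT" "x \<in> DT" for u x
    proof -
      have "\<Theta> z u = adj_on DT' V (\<Psi> z (U u))" using eq z that(1) by blast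
      moreover have "cinner (adj_on DT' V (\<Psi> z (U u))) (adj_on DT' V (C (U x)))
          = cinner (\<Psi> z (U u)) (C (U x))"
        by (intro unitary_onD(4)[OF W] bounded_opD(1)[OF b] antiunitary_onD(3)[OF Ca]
            unitary_onD(3)[OF U] that)
      ultimately show ?thesis by (simp add: J_def)
    qed
    show ?thesis
      using s unitary_onD(3)[OF U that(2)] unitary_onD(3)[OF U that(3)]
      by (simp add: form that(2,3))
  qed
  ultimately show ?thesis unfolding \<Theta>_symmetric_def by blast
qed

end


section \<open>Complex symmetric contractions\<close>

lemma defect_pair_adj:
  assumes T: "bounded_op UNIV UNIV T" and le: "contraction_on UNIV T"
  shows "defect_pair T (adj T) (defect_op T) (defect_op_star T)"
    and "selfadjoint_contraction (\<lambda>x. adj T (T x))" and "selfadjoint_contraction (\<lambda>x. T (adj T x))"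
    and "defect_op T = selfadjoint_contraction.root (\<lambda>x. adj T (T x))"
    and "defect_op_star T = selfadjoint_contraction.root (\<lambda>x. T (adj T x))"
proof -
  have le': "norm (T x) \<le> norm x" for x using le by (simp add: contraction_on_def)
  note T' = adj_contraction[OF T le']
  have adj: "cinner (T u) y = cinner u (adj T y)" for u y using cinner_adj_on[OF _ T] by simp
  have adj': "cinner (adj T u) y = cinner u (T y)" for u y by (metis adj cinner_commute)
  note lin = bounded_opD(2,3)[OF T, simplified] bounded_opD(2,3)[OF T'(1), simplified]
  show 1: "selfadjoint_contraction (\<lambda>x. adj T (T x))"
  proof
    show "norm (adj T (T x)) \<le> norm x" for x using T'(2) le' order_trans by blast
    then show "bounded_op UNIV UNIV (\<lambda>x. adj T (T x))"
      by (intro bounded_op_UNIV_I[where K=1]) (simp_all add: lin)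
    show "cinner (adj T (T x)) y = cinner x (adj T (T y))" for x y by (simp add: adj' flip: adj)
  qed
  show 2: "selfadjoint_contraction (\<lambda>x. T (adj T x))"
  proof
    show "norm (T (adj T x)) \<le> norm x" for x using T'(2) le' order_trans by blast
    then show "bounded_op UNIV UNIV (\<lambda>x. T (adj T x))"
      by (intro bounded_op_UNIV_I[where K=1]) (simp_all add: lin)
    show "cinner (T (adj T x)) y = cinner x (T (adj T y))" for x y by (simp add: adj flip: adj')
  qed
  interpret R: selfadjoint_contraction "\<lambda>x. adj T (T x)" by (rule 1)
  interpret R': selfadjoint_contraction "\<lambda>x. T (adj T x)" by (rule 2)
  show D: "defect_op T = R.root" unfolding defect_op_def by (rule R.op_sqrt_eq)
  show D': "defect_op_star T = R'.root" unfolding defect_op_star_def by (rule R'.op_sqrt_eq)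
  show "defect_pair T (adj T) (defect_op T) (defect_op_star T)"
    unfolding D D'
  proof
    show "T (R.root x) = R'.root (T x)" for x
      by (rule R.root_intertwine[OF bounded_op_UNIV_linear[OF T] 2]) simp
  qed (fact T T'(1) R.root_bounded R'.root_bounded adj R.root_sym R'.root_sym
      R.root_root R'.root_root)+
qed

lemma conjugation_symmetric_iff:
  assumes C: "conjugation_on UNIV C"
  shows "symmetric_on UNIV C T \<longleftrightarrow> (\<forall>x. C (T x) = adj T (C x))"
proof -
  have CC: "C (C x) = x" for x using C by (simp add: conjugation_on_def)
  show ?thesis unfolding symmetric_on_def by (metis CC UNIV_I)
qed

theorem theorem3p1:
  fixes T :: "'h::chilbert_space \<Rightarrow> 'h"
  assumes "bounded_op UNIV UNIV T" and "contraction_on UNIV T"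
  shows "(complex_symmetric T \<longleftrightarrow>
            (\<exists>J. antilinear_on (defect_space T) J
               \<and> (\<forall>x\<in>defect_space T. norm (J x) = norm x)
               \<and> J ` defect_space T = defect_space_star T
               \<and> (\<forall>z\<in>ball 0 1. \<forall>x\<in>defect_space T.
                    char_fun T z x = J (adj_on (defect_space T) (char_fun T z) (J x)))))
       \<and> (complex_symmetric T \<longleftrightarrow> coincides_with_symmetric TYPE('h) T)
       \<and> (coincides_with_symmetric TYPE('e::chilbert_space) T \<longrightarrow> complex_symmetric T)"
proof -
  interpret defect_pair T "adj T" "defect_op T" "defect_op_star T"
    by (rule defect_pair_adj[OF assms])
  have DT: "defect_space T = DT" "defect_space_star T = DT'"
    by (simp_all add: defect_space_def defect_space_star_def)
  have char: "char_fun T z = \<Theta> z" if "z \<in> ball 0 1" for z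
    using that by (intro ext) (simp add: char_fun_def \<Theta>_def inv_eq_res)

  have cs_iff: "complex_symmetric T \<longleftrightarrow> (\<exists>J. \<Theta>_symmetric J)"
  proof
    assume "complex_symmetric T"
    then obtain C where C: "conjugation_on UNIV C" "symmetric_on UNIV C T"
      unfolding complex_symmetric_def by blast
    have CT: "C (T x) = adj T (C x)" for x
      using C conjugation_symmetric_iff by blast
    have CC: "C (C x) = x" for x using C(1) by (simp add: conjugation_on_def)
    have CT': "C (adj T x) = T (C x)" for x using CT[of "C x"] by (metis CC)
    have CD: "C (defect_op T x) = defect_op_star T (C x)" for x
      unfolding defect_pair_adj(4,5)[OF assms]
      by (rule selfadjoint_contraction.root_intertwine[OF defect_pair_adj(2)[OF assms]
            conjugation_bounded_linear[OF C(1)] defect_pair_adj(3)[OF assms]])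
         (simp add: CT CT')
    have "\<Theta>_symmetric C"
      unfolding \<Theta>_symmetric_def \<Theta>_symmetric_iff
      using conjugation_imp_coef_symmetric[OF C(1) CT CD] by blast
    then show "\<exists>J. \<Theta>_symmetric J" by blast
  next
    assume "\<exists>J. \<Theta>_symmetric J"
    then obtain J where J: "antiunitary_on DT DT' J" "coef_symmetric J"
      unfolding \<Theta>_symmetric_def \<Theta>_symmetric_iff coef_symmetric_def by blast
    show "complex_symmetric T"
      unfolding complex_symmetric_def
      using conjugation_from_symmetric_coef[OF J] conjugation_symmetric_iff by blast
  qed

  have sym_iff: "\<Theta>_symmetric J \<longleftrightarrow> antilinear_on (defect_space T) J
      \<and> (\<forall>x\<in>defect_space T. norm (J x) = norm x)
      \<and> J ` defect_space T = defect_space_star T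
      \<and> (\<forall>z\<in>ball 0 1. \<forall>x\<in>defect_space T.
           char_fun T z x = J (adj_on (defect_space T) (char_fun T z) (J x)))" for J
  proof -
    have au: "antiunitary_on DT DT' J \<longleftrightarrow>
        antilinear_on DT J \<and> (\<forall>x\<in>DT. norm (J x) = norm x) \<and> J ` DT = DT'"
    proof
      assume "antiunitary_on DT DT' J"
      then show "antilinear_on DT J \<and> (\<forall>x\<in>DT. norm (J x) = norm x) \<and> J ` DT = DT'"
        using antiunitary_on_norm[of DT DT' J] by (simp add: antiunitary_on_def)
    next
      assume "antilinear_on DT J \<and> (\<forall>x\<in>DT. norm (J x) = norm x) \<and> J ` DT = DT'"
      then show "antiunitary_on DT DT' J"
        by (intro isometric_antilinear_imp_antiunitary[OF DT_subspace]) simp_all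
    qed
    have "(\<forall>z\<in>ball 0 1. \<forall>x\<in>DT. \<Theta> z x = J (adj_on DT (\<Theta> z) (J x))) \<longleftrightarrow>
        (\<forall>z\<in>ball 0 1. \<forall>u\<in>DT. \<forall>x\<in>DT. cinner (\<Theta> z u) (J x) = cinner (\<Theta> z x) (J u))"
      if "antiunitary_on DT DT' J"
    proof (rule ball_cong[OF refl])
      fix z :: complex assume "z \<in> ball 0 1"
      then have z: "cmod z < 1" by simp
      show "(\<forall>x\<in>DT. \<Theta> z x = J (adj_on DT (\<Theta> z) (J x))) \<longleftrightarrow>
        (\<forall>u\<in>DT. \<forall>x\<in>DT. cinner (\<Theta> z u) (J x) = cinner (\<Theta> z x) (J u))"
        by (rule adj_symmetric_iff[OF DT_subspace \<Theta>_bounded[OF z] that])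
    qed
    then have "\<Theta>_symmetric J \<longleftrightarrow> antiunitary_on DT DT' J \<and>
        (\<forall>z\<in>ball 0 1. \<forall>x\<in>DT. \<Theta> z x = J (adj_on DT (\<Theta> z) (J x)))"
      unfolding \<Theta>_symmetric_def by (rule conj_cong[OF refl, symmetric])
    then show ?thesis unfolding DT au by (simp only: char conj_assoc cong: ball_cong)
  qed

  have co: "coincide DT DT' (char_fun T) E E \<Psi> \<longleftrightarrow> coincide DT DT' \<Theta> E E \<Psi>"
    for E :: "'h set" and \<Psi>
    unfolding coincide_def by (simp add: char)
  have co': "coincide DT DT' (char_fun T) E E \<Psi> \<longleftrightarrow> coincide DT DT' \<Theta> E E \<Psi>"
    for E :: "'e set" and \<Psi>
    unfolding coincide_def by (simp add: char)
  have "\<exists>J. \<Theta>_symmetric J" if "coincides_with_symmetric TYPE('h) T"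
    using that symmetric_if_model unfolding coincides_with_symmetric_def DT co by blast
  moreover have "\<exists>J. \<Theta>_symmetric J" if "coincides_with_symmetric TYPE('e) T"
    using that symmetric_if_model unfolding coincides_with_symmetric_def DT co' by blast
  moreover have "coincides_with_symmetric TYPE('h) T" if "\<Theta>_symmetric J" for J
    using symmetric_model_exists[OF that] DT_subspace
    unfolding coincides_with_symmetric_def DT co by blast
  ultimately show ?thesis unfolding cs_iff sym_iff[symmetric] by blast
qed

end
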